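(* Let $b$ be an effective damping, let $m$ be a mass dominated by $b$, suppose that the pair $(b,m)$ satisfies the intrinsic accumulated-mass balance (with finite lower index $\beta\in[0,\infty)$ and some $T_0\ge 0$), and suppose that $(b,m)$ satisfies the global Liouville nonoscillation condition. Then the adjoint equation $$\rho''-(b\rho)'+m^2\rho=0$$ admits a solution $\rho\in C^2([0,\infty))$ such that $$\rho(t)>0,\qquad b(t)\rho(t)-\rho'(t)>0\qquad(t\ge 0),$$ and, for some constant $C>0$, $$|\rho'(t)|\le C\,b(t)\rho(t)\qquad(t\ge 0),$$ $$b(t)\rho(t)\le C(1+B(t))^{\beta}\exp\bigl(\Omega_{\beta,T_0}(\log(1+B(t)))\bigr)\qquad(t\ge 0).$$ More precisely, there exists $T_*\ge T_0$ such that $$\rho(t)\sim\frac{1}{b(t)}e^{Q(t,T_* )},\qquad t\ge T_*,$$ and $$\left|\frac{\rho'(t)}{b(t)\rho(t)}\right|\le\frac14,\qquad t\ge T_*.$$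
   Context: Effective damping: $b\in C^2([0,\infty))$ is positive and monotone; there is $C>0$ with $|b^{(k)}(t)|\le C b(t)(1+t)^{-k}$ for $k=1,2$ and all $t\ge0$; $tb(t)\to\infty$ as $t\to\infty$; $\frac{1}{b(t)(1+t)^2}\in L^1(0,\infty)$; and $tb'(t)\le a_0 b(t)$ for all $t\ge0$ for some $a_0\in[0,1)$. Dominated mass: $m\in C^2([0,\infty))$ is positive; there is $C>0$ with $|m^{(k)}(t)|\le C m(t)(1+t)^{-k}$ for $k=1,2$ and all $t\ge0$; and $m(t)=o(b(t))$ as $t\to\infty$. Notation: for $t\ge r\ge0$, $$B(t):=\int_0^t\frac{d\tau}{b(\tau)},\quad Q(t,r):=\int_r^t\frac{m^2(\tau)}{b(\tau)}\,d\tau,\quad X(t,r):=\frac{1+B(t)}{1+B(r)}\ge1.$$ Also $[s]_+:=\max\{s,0\}$. The lower mass index is $\beta:=\liminf_{t\to\infty}B(t)m^2(t)$. Intrinsic accumulated-mass balance: $\beta\in[0,\infty)$ is finite and there exists $T_0\ge0$ such that for every $L\ge0$ $$\Omega_{\beta,T_0}(L):=\sup_{t\ge r\ge T_0,\ \log X(t,r)\le L}\bigl[Q(t,r)-\beta\log X(t,r)\bigr]_+<\infty.$$ Global Liouville nonoscillation condition: $m^2(t)\le\frac{b^2(t)}4+\frac{b'(t)}2$ for every $t\ge0$. The notation $f\sim g$ on a set means that there is a constant $C\ge 1$ with $C^{-1}g\le f\le Cg$ on that set. *)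

theory Defs
  imports "HOL-Analysis.Analysis" "HOL-Library.Landau_Symbols"
begin

text \<open>
  Functions on the half-line \<open>[0,\<infinity>)\<close> are represented by functions \<open>real \<Rightarrow> real\<close>, of which only
  the values on \<open>{0..}\<close> matter. Derivatives are therefore taken within \<open>{0..}\<close>: they are the
  ordinary two-sided derivative for \<open>t > 0\<close> and the right derivative at \<open>t = 0\<close>.
\<close>

definition hderiv :: "(real \<Rightarrow> real) \<Rightarrow> real \<Rightarrow> real" where
  "hderiv f t = vector_derivative f (at t within {0..})"

definition C2_halfline :: "(real \<Rightarrow> real) \<Rightarrow> bool" where
  "C2_halfline f \<longleftrightarrow>
     f differentiable_on {0..} \<and>
     hderiv f differentiable_on {0..} \<and>
     continuous_on {0..} (hderiv (hderiv f))"

definition effective_damping :: "(real \<Rightarrow> real) \<Rightarrow> bool" where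
  "effective_damping b \<longleftrightarrow>
     C2_halfline b \<and>
     (\<forall>t\<ge>0. b t > 0) \<and>
     (mono_on {0..} b \<or> antimono_on {0..} b) \<and>
     (\<exists>C>0. \<forall>k\<in>{1, 2}. \<forall>t\<ge>0. \<bar>(hderiv ^^ k) b t\<bar> \<le> C * b t / (1 + t) ^ k) \<and>
     filterlim (\<lambda>t. t * b t) at_top at_top \<and>
     set_integrable lborel {0<..} (\<lambda>t. 1 / (b t * (1 + t)\<^sup>2)) \<and>
     (\<exists>a\<^sub>0\<in>{0..<1}. \<forall>t\<ge>0. t * hderiv b t \<le> a\<^sub>0 * b t)"

definition dominated_mass :: "(real \<Rightarrow> real) \<Rightarrow> (real \<Rightarrow> real) \<Rightarrow> bool" where
  "dominated_mass b m \<longleftrightarrow>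
     C2_halfline m \<and>
     (\<forall>t\<ge>0. m t > 0) \<and>
     (\<exists>C>0. \<forall>k\<in>{1, 2}. \<forall>t\<ge>0. \<bar>(hderiv ^^ k) m t\<bar> \<le> C * m t / (1 + t) ^ k) \<and>
     m \<in> o[at_top](b)"

definition B_int :: "(real \<Rightarrow> real) \<Rightarrow> real \<Rightarrow> real" where
  "B_int b t = integral {0..t} (\<lambda>\<tau>. 1 / b \<tau>)"

definition Q_int :: "(real \<Rightarrow> real) \<Rightarrow> (real \<Rightarrow> real) \<Rightarrow> real \<Rightarrow> real \<Rightarrow> real" where
  "Q_int b m t r = integral {r..t} (\<lambda>\<tau>. (m \<tau>)\<^sup>2 / b \<tau>)"

definition X_ratio :: "(real \<Rightarrow> real) \<Rightarrow> real \<Rightarrow> real \<Rightarrow> real" where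
  "X_ratio b t r = (1 + B_int b t) / (1 + B_int b r)"

text \<open>
  Both extremal quantities are taken in \<open>ereal\<close>, so that their finiteness is a genuine hypothesis.
  Under the balance condition \<open>mass_excess\<close> lies in \<open>[0,\<infinity>)\<close> for every \<open>L \<ge> 0\<close> (the pair \<open>t = r = T\<^sub>0\<close>
  is always admissible), so \<open>real_of_ereal\<close> recovers its value there.
\<close>

definition lower_mass_index :: "(real \<Rightarrow> real) \<Rightarrow> (real \<Rightarrow> real) \<Rightarrow> ereal" where
  "lower_mass_index b m = Liminf at_top (\<lambda>t. ereal (B_int b t * (m t)\<^sup>2))"

definition mass_excess ::
  "(real \<Rightarrow> real) \<Rightarrow> (real \<Rightarrow> real) \<Rightarrow> real \<Rightarrow> real \<Rightarrow> real \<Rightarrow> ereal" where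
  "mass_excess b m \<beta> T\<^sub>0 L =
     (SUP (t, r) \<in> {(t, r). t \<ge> r \<and> r \<ge> T\<^sub>0 \<and> ln (X_ratio b t r) \<le> L}.
        ereal (max (Q_int b m t r - \<beta> * ln (X_ratio b t r)) 0))"

definition accumulated_mass_balance ::
  "(real \<Rightarrow> real) \<Rightarrow> (real \<Rightarrow> real) \<Rightarrow> real \<Rightarrow> real \<Rightarrow> bool" where
  "accumulated_mass_balance b m \<beta> T\<^sub>0 \<longleftrightarrow>
     \<beta> \<ge> 0 \<and> lower_mass_index b m = ereal \<beta> \<and>
     T\<^sub>0 \<ge> 0 \<and> (\<forall>L\<ge>0. mass_excess b m \<beta> T\<^sub>0 L < \<infinity>)"

definition liouville_nonoscillation :: "(real \<Rightarrow> real) \<Rightarrow> (real \<Rightarrow> real) \<Rightarrow> bool" where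
  "liouville_nonoscillation b m \<longleftrightarrow>
     (\<forall>t\<ge>0. (m t)\<^sup>2 \<le> (b t)\<^sup>2 / 4 + hderiv b t / 2)"

definition adjoint_solution ::
  "(real \<Rightarrow> real) \<Rightarrow> (real \<Rightarrow> real) \<Rightarrow> (real \<Rightarrow> real) \<Rightarrow> bool" where
  "adjoint_solution b m \<rho> \<longleftrightarrow>
     C2_halfline \<rho> \<and>
     (\<forall>t\<ge>0. hderiv (hderiv \<rho>) t - hderiv (\<lambda>s. b s * \<rho> s) t + (m t)\<^sup>2 * \<rho> t = 0)"

definition comparable_on :: "real set \<Rightarrow> (real \<Rightarrow> real) \<Rightarrow> (real \<Rightarrow> real) \<Rightarrow> bool" where
  "comparable_on S f g \<longleftrightarrow> (\<exists>C\<ge>1. \<forall>t\<in>S. inverse C * g t \<le> f t \<and> f t \<le> C * g t)"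

end

theory Submission
  imports Defs
begin

text \<open>
  Put \<open>w = b \<rho> - \<rho>'\<close>, so that the adjoint equation becomes \<open>w' = m\<^sup>2 \<rho>\<close>. The substitution
  \<open>\<rho> = exp (\<integral> b / 2) z\<close> turns it into \<open>z'' = q z\<close> with \<open>q = b\<^sup>2 / 4 + b' / 2 - m\<^sup>2 \<ge> 0\<close>, and the
  positive decaying solution \<open>z\<close> has \<open>z' \<le> 0\<close>, which gives \<open>\<rho> > 0\<close>, \<open>w > 0\<close> and
  \<open>0 < \<sigma> \<le> 2\<close> for \<open>\<sigma> = b \<rho> / w\<close>. Since \<open>t / b\<close> is bounded by a multiple of \<open>B\<close>, windows
  \<open>[r, 2 r]\<close> have bounded logarithmic length, and the balance condition yields
  \<open>m\<^sup>2 = O(b / (1 + t))\<close>. The Riccati equation of \<open>\<sigma>\<close> then reads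
  \<open>\<sigma>' = b (\<sigma> - 1) + O(1 / (1 + t))\<close>, and the only bounded solutions of such an unstable equation
  satisfy \<open>\<sigma> - 1 = O(1 / (b (1 + t)))\<close>. Hence \<open>(ln w - Q)' = m\<^sup>2 (\<sigma> - 1) / b\<close> is dominated by the
  integrable function \<open>1 / (b (1 + t)\<^sup>2)\<close>, so \<open>w\<close> is comparable to \<open>exp Q\<close> and \<open>\<rho> = \<sigma> w / b\<close> to
  \<open>exp Q / b\<close>.
\<close>

section \<open>Calculus on the half-line\<close>

abbreviation has_hderiv :: "(real \<Rightarrow> real) \<Rightarrow> real \<Rightarrow> real \<Rightarrow> bool"
    (infix "has'_hderiv" 50) where
  "(f has_hderiv D) t \<equiv> (f has_real_derivative D) (at t within {0..})"

text \<open>Every point of the closed half-line is a limit point of it, the end point 0 included, so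
  derivatives within \<open>{0..}\<close> are unique.\<close>

lemma hderiv_eqI:
  assumes "(f has_hderiv D) t" "t \<ge> 0"
  shows "hderiv f t = D"
proof -
  have "at t within {0..} \<noteq> bot"
    using assms(2) islimpt_subset[of t "{t..t + 1}" "{0..}"] islimpt_Icc[of t "t + 1" t]
    by (auto simp: trivial_limit_within)
  then show ?thesis
    unfolding hderiv_def using assms(1)
    by (intro vector_derivative_within) (auto simp: has_real_derivative_iff_has_vector_derivative)
qed

lemma has_hderiv_hderiv:
  assumes "f differentiable_on {0..}" "t \<ge> 0"
  shows "(f has_hderiv hderiv f t) t"
proof -
  obtain D where "(f has_hderiv D) t"
    using assms unfolding differentiable_on_def real_differentiable_def by auto
  with hderiv_eqI[OF this assms(2)] show ?thesis by simp
qed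

lemma has_hderiv_cong:
  assumes "(f has_hderiv D) t" "t \<ge> 0" "\<And>s. s \<ge> 0 \<Longrightarrow> f s = g s"
  shows "(g has_hderiv D) t"
  using assms by (intro has_field_derivative_transform_within[OF assms(1) zero_less_one]) auto

lemma at_within_halfline_eq:
  assumes "0 \<le> t" "t < T"
  shows "at t within {0..} = at t within {0..T::real}"
  using assms by (intro at_within_nhd[of _ "{..<T}"]) auto

lemma hderiv_continuous_on:
  assumes "\<And>t. t \<ge> 0 \<Longrightarrow> (f has_hderiv f' t) t"
  shows "continuous_on {0..} f"
  using assms by (intro DERIV_continuous_on[of _ _ f']) auto

text \<open>The mean value theorem on \<open>{a..b}\<close>. It is the comparison tool of the whole
  development: an integral inequality is proved by moving both sides into one function and checking
  the sign of its derivative.\<close>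

lemma hderiv_nonneg_imp_le:
  assumes "0 \<le> a" "a \<le> b"
    and "\<And>x. a \<le> x \<Longrightarrow> x \<le> b \<Longrightarrow> (f has_hderiv f' x) x"
    and "\<And>x. a \<le> x \<Longrightarrow> x \<le> b \<Longrightarrow> f' x \<ge> 0"
  shows "f a \<le> f b"
proof (cases "a = b")
  case False
  have "(f has_derivative (*) (f' x)) (at x within {a..b})" if "a \<le> x" "x \<le> b" for x
    using DERIV_subset[OF assms(3)[OF that], of "{a..b}"] assms(1)
    by (auto simp: has_field_derivative_def)
  then obtain x where "x \<in> {a<..<b}" "f b - f a = f' x * (b - a)"
    using mvt_simple[of a b f "\<lambda>x. (*) (f' x)"] False assms(2) by auto
  moreover have "f' x * (b - a) \<ge> 0" using calculation assms by (intro mult_nonneg_nonneg) auto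
  ultimately show ?thesis by linarith
qed auto

lemma hderiv_pos_imp_less:
  assumes "0 \<le> a" "a < b"
    and "\<And>x. a \<le> x \<Longrightarrow> x \<le> b \<Longrightarrow> (f has_hderiv f' x) x"
    and "\<And>x. a \<le> x \<Longrightarrow> x \<le> b \<Longrightarrow> f' x > 0"
  shows "f a < f b"
proof -
  have "(f has_derivative (*) (f' x)) (at x within {a..b})" if "a \<le> x" "x \<le> b" for x
    using DERIV_subset[OF assms(3)[OF that], of "{a..b}"] assms(1)
    by (auto simp: has_field_derivative_def)
  then obtain x where "x \<in> {a<..<b}" "f b - f a = f' x * (b - a)"
    using mvt_simple[of a b f "\<lambda>x. (*) (f' x)"] assms(2) by auto
  moreover have "f' x * (b - a) > 0" using calculation assms by (intro mult_pos_pos) auto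
  ultimately show ?thesis by linarith
qed

lemma integral_has_hderiv:
  assumes "continuous_on {0..} g" "0 \<le> t"
  shows "((\<lambda>x. integral {0..x} g) has_hderiv g t) t"
proof -
  have "((\<lambda>x. integral {0..x} g) has_real_derivative g t) (at t within {0..t+1})"
    using assms by (intro integral_has_real_derivative) (auto intro: continuous_on_subset)
  then show ?thesis using at_within_halfline_eq[of t "t+1"] assms by simp
qed

lemma integral_halfline_split:
  fixes g :: "real \<Rightarrow> real"
  assumes "continuous_on {0..} g" "0 \<le> r" "r \<le> t"
  shows "integral {r..t} g = integral {0..t} g - integral {0..r} g"
proof -
  have "g integrable_on {0..t}"
    by (intro integrable_continuous_real continuous_on_subset[OF assms(1)]) auto
  from Henstock_Kurzweil_Integration.integral_combine[OF assms(2,3) this] show ?thesis by simp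
qed

lemma continuous_bounded_initial:
  fixes f :: "real \<Rightarrow> real"
  assumes "continuous_on {0..} f"
  obtains M where "M > 0" "\<And>t. 0 \<le> t \<Longrightarrow> t \<le> T \<Longrightarrow> \<bar>f t\<bar> \<le> M"
proof -
  have "compact (f ` {0..T})"
    by (intro compact_continuous_image continuous_on_subset[OF assms]) auto
  then have "bounded (f ` {0..T})" by (rule compact_imp_bounded)
  then obtain M where "M > 0" "\<forall>y\<in>f ` {0..T}. norm y \<le> M"
    unfolding bounded_pos by blast
  then show ?thesis by (intro that[of M]) auto
qed

section \<open>The principal solution of a disconjugate equation\<close>

text \<open>These are the single summands, not the partial sums, of the Neumann series for the
  solution with z(0) = 1 and z'(0) = 0.\<close>

primrec picard_term :: "(real \<Rightarrow> real) \<Rightarrow> nat \<Rightarrow> real \<Rightarrow> real" where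
  "picard_term q 0 = (\<lambda>t. 1)"
| "picard_term q (Suc n) =
     (\<lambda>t. integral {0..t} (\<lambda>s. integral {0..s} (\<lambda>u. q u * picard_term q n u)))"

text \<open>Explicit first derivative of \<open>picard_term q n\<close>. The summand of index 0 is
  constant, hence the value 0 there.\<close>

definition picard_slope :: "(real \<Rightarrow> real) \<Rightarrow> nat \<Rightarrow> real \<Rightarrow> real" where
  "picard_slope q n t = (case n of 0 \<Rightarrow> 0 | Suc k \<Rightarrow> integral {0..t} (\<lambda>u. q u * picard_term q k u))"

definition picard_curvature :: "(real \<Rightarrow> real) \<Rightarrow> nat \<Rightarrow> real \<Rightarrow> real" where
  "picard_curvature q n t = (case n of 0 \<Rightarrow> 0 | Suc k \<Rightarrow> q t * picard_term q k t)"

lemma picard_term_continuous: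
  assumes "continuous_on {0..} q"
  shows "continuous_on {0..} (picard_term q n)"
proof (induction n)
  case (Suc n)
  have c: "continuous_on {0..} (\<lambda>u. q u * picard_term q n u)"
    by (intro continuous_intros assms Suc)
  have "continuous_on {0..} (\<lambda>s. integral {0..s} (\<lambda>u. q u * picard_term q n u))"
    by (rule hderiv_continuous_on) (rule integral_has_hderiv[OF c], auto)
  from integral_has_hderiv[OF this] show ?case
    by (auto intro!: hderiv_continuous_on)
qed simp

lemma picard_slope_has_hderiv:
  assumes "continuous_on {0..} q" "t \<ge> 0"
  shows "(picard_slope q n has_hderiv picard_curvature q n t) t"
proof (cases n)
  case (Suc k)
  have "continuous_on {0..} (\<lambda>u. q u * picard_term q k u)"
    by (intro continuous_intros assms(1) picard_term_continuous)
  from integral_has_hderiv[OF this assms(2)] show ?thesis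
    by (simp add: Suc picard_slope_def [abs_def] picard_curvature_def)
qed (simp add: picard_slope_def [abs_def] picard_curvature_def)

lemma picard_term_has_hderiv:
  assumes "continuous_on {0..} q" "t \<ge> 0"
  shows "(picard_term q n has_hderiv picard_slope q n t) t"
proof (cases n)
  case (Suc k)
  have "continuous_on {0..} (picard_slope q n)"
    by (rule hderiv_continuous_on) (rule picard_slope_has_hderiv[OF assms(1)])
  from integral_has_hderiv[OF this assms(2)] show ?thesis
    by (simp add: Suc picard_slope_def [abs_def])
qed (simp add: picard_slope_def [abs_def])

lemma picard_nonneg:
  assumes "continuous_on {0..} q" "\<And>t. t \<ge> 0 \<Longrightarrow> q t \<ge> 0" "t \<ge> 0"
  shows "picard_term q n t \<ge> 0" "picard_slope q n t \<ge> 0"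
proof -
  have "\<forall>t\<ge>0. picard_term q n t \<ge> 0 \<and> picard_slope q n t \<ge> 0"
  proof (induction n)
    case (Suc n)
    have curv: "picard_curvature q (Suc n) t \<ge> 0" if "t \<ge> 0" for t
      using Suc assms(2)[OF that] that by (simp add: picard_curvature_def)
    have s: "picard_slope q (Suc n) t \<ge> 0" if "t \<ge> 0" for t
    proof -
      have "picard_slope q (Suc n) 0 \<le> picard_slope q (Suc n) t"
        using that by (intro hderiv_nonneg_imp_le[OF _ _ picard_slope_has_hderiv[OF assms(1)]] curv) auto
      then show ?thesis by (simp add: picard_slope_def)
    qed
    have "picard_term q (Suc n) 0 \<le> picard_term q (Suc n) t" if "t \<ge> 0" for t
      using that by (intro hderiv_nonneg_imp_le[OF _ _ picard_term_has_hderiv[OF assms(1)]]) (auto intro: s)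
    then show ?case using s by simp
  qed (simp add: picard_slope_def)
  with assms(3) show "picard_term q n t \<ge> 0" "picard_slope q n t \<ge> 0" by auto
qed

text \<open>Not the sharp bound with (2n)!: of the two integrations in each step, the inner one is
  estimated crudely by the length of the interval, and the outer one alone produces the factorial.
  This suffices for summability on \<open>{0..T}\<close>.\<close>

lemma picard_bound:
  assumes q: "continuous_on {0..} q" "\<And>t. t \<ge> 0 \<Longrightarrow> q t \<ge> 0"
    and M: "\<And>t. 0 \<le> t \<Longrightarrow> t \<le> T \<Longrightarrow> q t \<le> M" and t: "0 \<le> t" "t \<le> T"
  shows "picard_term q n t \<le> (M * T * t) ^ n / fact n"
    and "picard_slope q (Suc n) t \<le> M * T * ((M * T * t) ^ n / fact n)"
proof -
  have M0: "M \<ge> 0" using q(2)[of t] M[of t] t by linarith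
  have slope: "picard_slope q (Suc n) t \<le> M * T * ((M * T * t) ^ n / fact n)"
    if IH: "\<And>t. 0 \<le> t \<Longrightarrow> t \<le> T \<Longrightarrow> picard_term q n t \<le> (M * T * t) ^ n / fact n" and t: "0 \<le> t" "t \<le> T" for n t
  proof -
    have T0: "T \<ge> 0" using t by simp
    \<comment> \<open>The integrand of the slope is at most its bound at the right end
      \<open>t\<close>; the length \<open>t\<close> of the interval is then enlarged to
      \<open>T\<close>.\<close>
    let ?c = "M * ((M * T * t) ^ n / fact n)"
    have "?c * 0 - picard_slope q (Suc n) 0 \<le> ?c * t - picard_slope q (Suc n) t"
    proof (rule hderiv_nonneg_imp_le[where f = "\<lambda>x. ?c * x - picard_slope q (Suc n) x"
          and f' = "\<lambda>x. ?c - picard_curvature q (Suc n) x"])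
      fix x assume x: "0 \<le> x" "x \<le> t"
      show "((\<lambda>x. ?c * x - picard_slope q (Suc n) x) has_hderiv ?c - picard_curvature q (Suc n) x) x"
        using picard_slope_has_hderiv[OF q(1) x(1)] by (auto intro!: derivative_eq_intros)
      have "picard_term q n x \<le> (M * T * t) ^ n / fact n"
        using IH[of x] x t M0 T0
        by (intro order_trans[OF IH] divide_right_mono power_mono mult_left_mono mult_nonneg_nonneg) auto
      then have "q x * picard_term q n x \<le> ?c"
        using M[of x] x t M0 by (intro mult_mono picard_nonneg[OF q]) auto
      then show "?c - picard_curvature q (Suc n) x \<ge> 0" by (simp add: picard_curvature_def)
    qed (use t in auto)
    then have "picard_slope q (Suc n) t \<le> ?c * t" by (simp add: picard_slope_def)
    also have "\<dots> \<le> ?c * T" using t M0 T0 by (intro mult_left_mono) auto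
    finally show ?thesis by (simp add: mult_ac)
  qed
  have iter: "\<forall>t. 0 \<le> t \<longrightarrow> t \<le> T \<longrightarrow> picard_term q n t \<le> (M * T * t) ^ n / fact n"
  proof (induction n)
    case (Suc n)
    show ?case
    proof (intro allI impI)
      fix t assume t: "0 \<le> t" "t \<le> T"
      let ?g = "\<lambda>x. (M * T * x) ^ Suc n / fact (Suc n)"
      have "?g 0 - picard_term q (Suc n) 0 \<le> ?g t - picard_term q (Suc n) t"
      proof (rule hderiv_nonneg_imp_le[where f = "\<lambda>x. ?g x - picard_term q (Suc n) x" and
          f' = "\<lambda>x. M * T * ((M * T * x) ^ n / fact n) - picard_slope q (Suc n) x"])
        fix x assume x: "0 \<le> x" "x \<le> t"
        have "(?g has_hderiv (real (Suc n) * (M * T * x) ^ n * (M * T)) / fact (Suc n)) x"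
          by (auto intro!: derivative_eq_intros simp del: fact_Suc of_nat_Suc power_Suc)
        also have "(real (Suc n) * (M * T * x) ^ n * (M * T)) / fact (Suc n) = M * T * ((M * T * x) ^ n / fact n)"
          by (simp add: divide_simps del: of_nat_Suc)
        finally show "((\<lambda>x. ?g x - picard_term q (Suc n) x) has_hderiv
            M * T * ((M * T * x) ^ n / fact n) - picard_slope q (Suc n) x) x"
          by (intro DERIV_diff picard_term_has_hderiv[OF q(1) x(1)])
        show "M * T * ((M * T * x) ^ n / fact n) - picard_slope q (Suc n) x \<ge> 0"
          using slope[of n x] Suc x t by auto
      qed (use t in auto)
      then show "picard_term q (Suc n) t \<le> ?g t" by simp
    qed
  qed simp
  show "picard_term q n t \<le> (M * T * t) ^ n / fact n" using iter t by auto
  show "picard_slope q (Suc n) t \<le> M * T * ((M * T * t) ^ n / fact n)"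
    using slope[of n t] iter t by auto
qed

text \<open>The series converges uniformly on compact intervals together with its first two
  derivative series, so it may be differentiated term by term. All summands are nonnegative and the
  first is 1, which gives the two sign conditions.\<close>

lemma linear_second_order_solution:
  assumes q: "continuous_on {0..} q" "\<And>t. t \<ge> 0 \<Longrightarrow> q t \<ge> 0"
  obtains z z' where "\<And>t. t \<ge> 0 \<Longrightarrow> (z has_hderiv z' t) t"
    "\<And>t. t \<ge> 0 \<Longrightarrow> (z' has_hderiv q t * z t) t"
    "\<And>t. t \<ge> 0 \<Longrightarrow> z t \<ge> 1" "\<And>t. t \<ge> 0 \<Longrightarrow> z' t \<ge> 0"
proof -
  define z where "z t = (\<Sum>n. picard_term q n t)" for t
  define z' where "z' t = (\<Sum>n. picard_slope q n t)" for t
  have main: "(z has_hderiv z' t) t" "(z' has_hderiv q t * z t) t"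
    "summable (\<lambda>n. picard_term q n t)" "summable (\<lambda>n. picard_slope q n t)" if t: "t \<ge> 0" for t
  proof -
    \<comment> \<open>One unit beyond \<open>t\<close>, so that near \<open>t\<close> the interval
      \<open>{0..T}\<close> coincides with the half-line and derivatives within either set agree at
      \<open>t\<close>.\<close>
    define T where "T = t + 1"
    obtain M where M: "\<And>s. 0 \<le> s \<Longrightarrow> s \<le> T \<Longrightarrow> q s \<le> M"
      using continuous_bounded_initial[OF q(1), of T] by (metis abs_le_D1)
    have M0: "M \<ge> 0" and T0: "T \<ge> 0" using q(2)[of t] M[of t] t by (auto simp: T_def)
    define e where "e n = (M * T * T) ^ n / fact n" for n
    have e_sum: "summable e" unfolding e_def using summable_exp[of "M * T * T"] by (simp add: field_simps)
    have term_le: "\<bar>picard_term q n s\<bar> \<le> e n" and slope_le: "\<bar>picard_slope q (Suc n) s\<bar> \<le> M * T * e n"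
      if s: "0 \<le> s" "s \<le> T" for s n
    proof -
      have le: "(M * T * s) ^ n / fact n \<le> e n"
        unfolding e_def using s M0 T0 by (intro divide_right_mono power_mono mult_left_mono) auto
      show "\<bar>picard_term q n s\<bar> \<le> e n"
        using picard_bound(1)[OF q M s, of n] picard_nonneg(1)[OF q s(1), of n] le by auto
      have "M * T * ((M * T * s) ^ n / fact n) \<le> M * T * e n"
        using le M0 T0 by (intro mult_left_mono) auto
      then show "\<bar>picard_slope q (Suc n) s\<bar> \<le> M * T * e n"
        using picard_bound(2)[OF q M s, of n] picard_nonneg(2)[OF q s(1), of "Suc n"] by linarith
    qed
    \<comment> \<open>Slope and curvature of index n are controlled by the summand of index n - 1,
      hence the shifted majorants; both vanish at index 0.\<close>
    define e1 where "e1 n = (case n of 0 \<Rightarrow> 0 | Suc k \<Rightarrow> M * T * e k)" for n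
    define e2 where "e2 n = (case n of 0 \<Rightarrow> 0 | Suc k \<Rightarrow> M * e k)" for n
    have "summable (\<lambda>n. e1 (Suc n))" "summable (\<lambda>n. e2 (Suc n))"
      using summable_mult[OF e_sum] by (simp_all add: e1_def e2_def)
    then have e1: "summable e1" and e2: "summable e2" by (simp_all only: summable_Suc_iff)
    have b1: "norm (picard_slope q n s) \<le> e1 n" if "s \<in> {0..T}" for n s
      using slope_le[of s] that by (auto simp: e1_def picard_slope_def[of _ 0] split: nat.splits)
    have b2: "norm (picard_curvature q n s) \<le> e2 n" if "s \<in> {0..T}" for n s
    proof (cases n)
      case (Suc k)
      have "\<bar>q s\<bar> * \<bar>picard_term q k s\<bar> \<le> M * e k"
        using term_le[of s k] M[of s] q(2)[of s] that M0 by (intro mult_mono) auto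
      then show ?thesis by (simp add: Suc e2_def picard_curvature_def abs_mult)
    qed (simp add: e2_def picard_curvature_def)
    have deriv1: "(picard_term q n has_field_derivative picard_slope q n s) (at s within {0..T})"
      and deriv2: "(picard_slope q n has_field_derivative picard_curvature q n s) (at s within {0..T})"
      if "s \<in> {0..T}" for n s
      using that by (auto intro!: DERIV_subset[OF picard_term_has_hderiv[OF q(1)]]
          DERIV_subset[OF picard_slope_has_hderiv[OF q(1)]])
    have sum1: "summable (\<lambda>n. picard_term q n s)" if "s \<in> {0..T}" for s
      using term_le[of s] that by (intro summable_comparison_test'[OF e_sum]) auto
    have sum2: "summable (\<lambda>n. picard_slope q n s)" if "s \<in> {0..T}" for s
      using b1[of s] that by (intro summable_comparison_test'[OF e1]) auto
    have t_in: "t \<in> {0..T}" using t by (simp add: T_def)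
    obtain g1 where g1: "\<And>x. x \<in> {0..T} \<Longrightarrow> (\<lambda>n. picard_term q n x) sums g1 x"
      "\<And>x. x \<in> {0..T} \<Longrightarrow> (g1 has_field_derivative z' x) (at x within {0..T})"
      using has_field_derivative_series[OF convex_real_interval(5) deriv1
          Weierstrass_m_test[OF b1 e1] t_in sum1[OF t_in]] unfolding z'_def by blast
    obtain g2 where g2: "\<And>x. x \<in> {0..T} \<Longrightarrow> (\<lambda>n. picard_slope q n x) sums g2 x"
      "\<And>x. x \<in> {0..T} \<Longrightarrow> (g2 has_field_derivative (\<Sum>n. picard_curvature q n x)) (at x within {0..T})"
      using has_field_derivative_series[OF convex_real_interval(5) deriv2
          Weierstrass_m_test[OF b2 e2] t_in sum2[OF t_in]] by blast
    have z_eq: "g1 x = z x" "g2 x = z' x" if "x \<in> {0..T}" for x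
      using g1(1)[OF that] g2(1)[OF that] by (auto simp: z_def z'_def sums_iff)
    \<comment> \<open>The recursion multiplies the preceding summand by \<open>q\<close>, so after
      an index shift the sum of second derivatives is \<open>q\<close> times the series
      itself.\<close>
    have curv: "(\<Sum>n. picard_curvature q n t) = q t * z t"
    proof -
      have "(\<lambda>n. picard_curvature q (Suc n) t) sums (q t * z t)"
        unfolding picard_curvature_def z_def
        using sums_mult[OF summable_sums[OF sum1[OF t_in]], of "q t"] by simp
      then have "(\<lambda>n. picard_curvature q n t) sums (q t * z t)"
        by (subst (asm) sums_Suc_iff) (simp add: picard_curvature_def)
      then show ?thesis by (simp add: sums_iff)
    qed
    have within: "at t within {0..} = at t within {0..T}"
      using t by (intro at_within_halfline_eq) (auto simp: T_def)
    show "(z has_hderiv z' t) t"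
      unfolding within
      by (rule has_field_derivative_transform_within[OF g1(2)[OF t_in] zero_less_one t_in])
        (simp add: z_eq)
    show "(z' has_hderiv q t * z t) t"
      unfolding within curv[symmetric]
      by (rule has_field_derivative_transform_within[OF g2(2)[OF t_in] zero_less_one t_in])
        (simp add: z_eq)
    show "summable (\<lambda>n. picard_term q n t)" "summable (\<lambda>n. picard_slope q n t)"
      using sum1 sum2 t_in by auto
  qed
  show ?thesis
  proof (rule that)
    fix t :: real assume t: "t \<ge> 0"
    show "z t \<ge> 1"
      using sum_le_suminf[OF main(3)[OF t], of "{0}"] picard_nonneg(1)[OF q t] by (simp add: z_def)
    show "z' t \<ge> 0"
      unfolding z'_def by (intro suminf_nonneg main(4) t picard_nonneg(2) q)
  qed (use main in auto)
qed

text \<open>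
  Reduction of order: if \<^term>\<open>y \<ge> 1\<close> solves the equation and is eventually strictly increasing,
  then \<^term>\<open>G t = integral {0..t} (\<lambda>s. 1 / (y s)\<^sup>2)\<close> has a finite limit \<^term>\<open>K\<close>, and
  \<^term>\<open>y t * (K - G t)\<close> is the decaying solution.
\<close>

lemma principal_solution:
  assumes q: "continuous_on {0..} q" "\<And>t. t \<ge> 0 \<Longrightarrow> q t \<ge> 0"
    and T: "T \<ge> 0" "\<And>t. t \<ge> T \<Longrightarrow> q t > 0"
  obtains z z' where "\<And>t. t \<ge> 0 \<Longrightarrow> (z has_hderiv z' t) t"
    "\<And>t. t \<ge> 0 \<Longrightarrow> (z' has_hderiv q t * z t) t"
    "\<And>t. t \<ge> 0 \<Longrightarrow> z t > 0" "\<And>t. t \<ge> 0 \<Longrightarrow> z' t \<le> 0"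
proof -
  obtain y y' where y: "\<And>t. t \<ge> 0 \<Longrightarrow> (y has_hderiv y' t) t"
    and y': "\<And>t. t \<ge> 0 \<Longrightarrow> (y' has_hderiv q t * y t) t"
    and ge: "\<And>t. t \<ge> 0 \<Longrightarrow> y t \<ge> 1" "\<And>t. t \<ge> 0 \<Longrightarrow> y' t \<ge> 0"
    using linear_second_order_solution[OF q] by blast
  have y_pos: "y t > 0" if "t \<ge> 0" for t using ge(1)[OF that] by linarith
  have y'_mono: "y' s \<le> y' t" if "0 \<le> s" "s \<le> t" for s t
    using that q(2) y_pos
    by (intro hderiv_nonneg_imp_le[OF _ _ y']) (auto simp: less_imp_le)
  \<comment> \<open>Beyond \<open>T\<close> the slope increases strictly because
    \<open>q > 0\<close>, so it is positive at \<open>T + 1\<close> and stays at least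
    \<open>c\<close> from there on.\<close>
  define c where "c = y' (T + 1)"
  have "y' T < y' (T + 1)"
    using T y_pos by (intro hderiv_pos_imp_less[OF _ _ y']) auto
  then have c: "c > 0" using ge(2)[OF T(1)] by (simp add: c_def)
  define G where "G t = integral {0..t} (\<lambda>s. 1 / (y s)\<^sup>2)" for t
  have "continuous_on {0..} (\<lambda>s. 1 / (y s)\<^sup>2)"
    using y_pos by (intro continuous_intros hderiv_continuous_on[OF y]) (auto simp: less_imp_neq[symmetric])
  then have G: "(G has_hderiv 1 / (y t)\<^sup>2) t" if "t \<ge> 0" for t
    unfolding G_def [abs_def] using that by (rule integral_has_hderiv)
  have G_less: "G s < G t" if "0 \<le> s" "s < t" for s t
    using that y_pos by (intro hderiv_pos_imp_less[OF _ _ G]) (auto simp: less_imp_neq[symmetric])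
  \<comment> \<open>As y' \<ge> c beyond \<open>T + 1\<close>, the derivative 1 / y^2 of
    \<open>G\<close> is at most that of - 1 / (c y). Hence G + 1 / (c y) does not increase there,
    and \<open>U\<close> is its starting value.\<close>
  define U where "U = G (T + 1) + 1 / (c * y (T + 1))"
  have G_le_U: "G t \<le> U" if "t \<ge> T + 1" for t
  proof -
    let ?f = "\<lambda>x. - (G x + 1 / (c * y x))"
    have "?f (T + 1) \<le> ?f t"
    proof (rule hderiv_nonneg_imp_le[where f = ?f and f' = "\<lambda>x. (y' x - c) / (c * (y x)\<^sup>2)"])
      fix x assume x: "T + 1 \<le> x" "x \<le> t"
      then have x0: "x \<ge> 0" using T by simp
      show "(?f has_hderiv (y' x - c) / (c * (y x)\<^sup>2)) x"
        using c y_pos[OF x0]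
        by (auto intro!: derivative_eq_intros G[OF x0] y[OF x0] simp: field_simps power2_eq_square)
      show "(y' x - c) / (c * (y x)\<^sup>2) \<ge> 0"
        using y'_mono[of "T + 1" x] c x T by (auto simp: c_def)
    qed (use T that in auto)
    moreover have "1 / (c * y t) > 0" using c y_pos[of t] that T by simp
    ultimately show ?thesis unfolding U_def by linarith
  qed
  have G_le_U': "G t \<le> U" if "t \<ge> 0" for t
    using G_le_U[of "max t (T + 1) + 1"] G_less[of t "max t (T + 1) + 1"] that
    by (smt (verit))
  define K where "K = (SUP t\<in>{0..}. G t)"
  have bdd: "bdd_above (G ` {0..})" using G_le_U' by (intro bdd_aboveI2[where M = U]) auto
  have G_less_K: "G t < K" if "t \<ge> 0" for t
    using G_less[of t "t + 1"] cSUP_upper[OF _ bdd, of "t + 1"] that by (auto simp: K_def)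
  \<comment> \<open>This is the monotonicity z' \<le> 0 of the decaying solution. As
    \<open>y'\<close> is nondecreasing, y'(t) times the integral of 1 / y^2 over [t, \<infinity>) is
    at most the integral of y' / y^2, which is at most 1 / y(t).\<close>
  have key: "y' t * (K - G t) \<le> 1 / y t" if t: "t \<ge> 0" for t
  proof (cases "y' t = 0")
    case False
    then have pos: "y' t > 0" using ge(2)[OF t] by simp
    have "G u \<le> G t + 1 / (y t * y' t)" if u: "u \<ge> 0" for u
    proof (cases "u \<le> t")
      case True
      then have "G u \<le> G t" using G_less[of u t] u by (cases "u = t") auto
      then show ?thesis using y_pos[OF t] pos by (intro order_trans[OF _ add_increasing2[OF _ order_refl]]) auto
    next
      case False
      let ?f = "\<lambda>x. - (y' t * G x + 1 / y x)"
      have "?f t \<le> ?f u"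
      proof (rule hderiv_nonneg_imp_le[where f = ?f and f' = "\<lambda>x. (y' x - y' t) / (y x)\<^sup>2"])
        fix x assume x: "t \<le> x" "x \<le> u"
        then have x0: "x \<ge> 0" using t by simp
        show "(?f has_hderiv (y' x - y' t) / (y x)\<^sup>2) x"
          using y_pos[OF x0]
          by (auto intro!: derivative_eq_intros G[OF x0] y[OF x0] simp: field_simps power2_eq_square)
        show "(y' x - y' t) / (y x)\<^sup>2 \<ge> 0" using y'_mono[of t x] x t by auto
      qed (use False t in auto)
      moreover have "1 / y u > 0" using y_pos[OF u] by simp
      ultimately have "y' t * G u \<le> y' t * G t + 1 / y t" by linarith
      then have "y' t * G u \<le> y' t * (G t + 1 / (y t * y' t))"
        using pos y_pos[OF t] by (simp add: distrib_left)
      then show ?thesis using pos by (simp only: mult_le_cancel_left_pos)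
    qed
    then have "K \<le> G t + 1 / (y t * y' t)"
      unfolding K_def by (intro cSUP_least) auto
    then have "y' t * K \<le> y' t * (G t + 1 / (y t * y' t))" using pos by (intro mult_left_mono) auto
    also have "\<dots> = y' t * G t + 1 / y t" using pos y_pos[OF t] by (simp add: distrib_left)
    finally show ?thesis by (simp add: algebra_simps)
  qed (use y_pos[OF t] in \<open>simp add: less_imp_le\<close>)
  show ?thesis
  proof (rule that)
    fix t :: real assume t: "t \<ge> 0"
    show "((\<lambda>t. y t * (K - G t)) has_hderiv y' t * (K - G t) - 1 / y t) t"
      using y_pos[OF t]
      by (auto intro!: derivative_eq_intros G[OF t] y[OF t] simp: field_simps power2_eq_square)
    show "((\<lambda>t. y' t * (K - G t) - 1 / y t) has_hderiv q t * (y t * (K - G t))) t"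
      using y_pos[OF t]
      by (auto intro!: derivative_eq_intros G[OF t] y[OF t] y'[OF t] simp: field_simps power2_eq_square)
    show "y t * (K - G t) > 0" using y_pos[OF t] G_less_K[OF t] by simp
    show "y' t * (K - G t) - 1 / y t \<le> 0" using key[OF t] by simp
  qed
qed

section \<open>Bounded solutions of an unstable first-order equation\<close>

text \<open>If \<^term>\<open>e\<close> left the barrier \<^term>\<open>A / (b t * (1 + t))\<close> once, the distance to it would from then on
  grow at least like the exponential of \<^term>\<open>integral {0..t} b\<close>.\<close>

lemma unstable_upper_barrier:
  fixes b e :: "real \<Rightarrow> real"
  assumes b: "\<And>t. t \<ge> 0 \<Longrightarrow> (b has_hderiv b' t) t" "\<And>t. t \<ge> 0 \<Longrightarrow> b t > 0"
    and b': "\<And>t. t \<ge> 0 \<Longrightarrow> \<bar>b' t\<bar> \<le> C * b t / (1 + t)"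
    and T: "T \<ge> 0" "\<And>t. t \<ge> T \<Longrightarrow> 2 * (C + 1) \<le> b t * (1 + t)" "\<And>t. t \<ge> T \<Longrightarrow> b t * (1 + t) \<ge> 1"
    and H: "H \<ge> 0"
    and e: "\<And>t. t \<ge> T \<Longrightarrow> (e has_hderiv e' t) t" "\<And>t. t \<ge> T \<Longrightarrow> e t \<le> 1"
      "\<And>t. t \<ge> T \<Longrightarrow> e' t \<ge> b t * e t - H / (1 + t)"
    and t0: "t0 \<ge> T"
  shows "e t0 \<le> 2 * H / (b t0 * (1 + t0))"
proof (rule ccontr)
  \<comment> \<open>With the factor 2, half of b \<phi> equals the forcing bound H / (1 + t), and
    the other half absorbs \<phi>', since |\<phi>'| \<le> b \<phi> / 2 by the lower bound on b (1 +
    t). What remains is d' \<ge> b d.\<close>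
  define A where "A = 2 * H"
  define \<phi> where "\<phi> t = A / (b t * (1 + t))" for t
  define \<phi>' where "\<phi>' t = - \<phi> t * (b' t / b t + 1 / (1 + t))" for t
  have A: "A \<ge> 0" using H by (simp add: A_def)
  have phi: "(\<phi> has_hderiv \<phi>' t) t" if "t \<ge> 0" for t
  proof -
    have nz: "b t \<noteq> 0" "1 + t \<noteq> 0" using b(2)[OF that] that by auto
    have "(\<phi> has_hderiv - A * (b' t * (1 + t) + b t) / (b t * (1 + t))\<^sup>2) t"
      unfolding \<phi>_def [abs_def] using nz
      by (auto intro!: derivative_eq_intros b(1)[OF that] simp: power2_eq_square)
    also have "- A * (b' t * (1 + t) + b t) / (b t * (1 + t))\<^sup>2 = \<phi>' t"
      using nz by (simp add: \<phi>_def \<phi>'_def divide_simps) algebra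
    finally show ?thesis .
  qed
  have phi0: "\<phi> t \<ge> 0" if "t \<ge> 0" for t using b(2)[OF that] that A by (simp add: \<phi>_def)
  assume "\<not> e t0 \<le> 2 * H / (b t0 * (1 + t0))"
  then have \<delta>: "e t0 - \<phi> t0 > 0" by (simp add: \<phi>_def A_def)
  define d where "d t = e t - \<phi> t" for t
  define P where "P t = integral {0..t} b" for t
  have P: "(P has_hderiv b t) t" if "t \<ge> 0" for t
    unfolding P_def [abs_def] by (intro integral_has_hderiv hderiv_continuous_on[OF b(1)] that)
  have d_ge: "e' t - \<phi>' t \<ge> b t * d t" if t: "t \<ge> T" for t
  proof -
    have t0: "t \<ge> 0" using t T by simp
    have bt: "b t > 0" using b(2)[OF t0] .
    have "\<bar>b' t / b t + 1 / (1 + t)\<bar> \<le> \<bar>b' t / b t\<bar> + 1 / (1 + t)"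
      using t0 by (intro order_trans[OF abs_triangle_ineq]) auto
    also have "\<bar>b' t / b t\<bar> \<le> C / (1 + t)"
      using b'[OF t0] bt t0 by (simp add: abs_divide field_simps)
    also have "C / (1 + t) + 1 / (1 + t) = (C + 1) / (1 + t)" by (simp add: add_divide_distrib)
    also have "\<dots> \<le> b t / 2"
      using T(2)[OF t] t0 by (simp add: field_simps)
    finally have "b' t / b t + 1 / (1 + t) \<ge> - (b t / 2)" by linarith
    from mult_left_mono[OF this phi0[OF t0]] have "\<phi>' t \<le> \<phi> t * (b t / 2)"
      by (simp add: \<phi>'_def)
    moreover have "\<phi> t * (b t / 2) = H / (1 + t)" using bt t0 by (simp add: \<phi>_def A_def divide_simps)
    ultimately show ?thesis using e(3)[OF t] by (simp add: d_def algebra_simps)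
  qed
  have grow: "d t0 * exp (- P t0) \<le> d t * exp (- P t)" if t: "t \<ge> t0" for t
  proof (rule hderiv_nonneg_imp_le[where f = "\<lambda>t. d t * exp (- P t)"
        and f' = "\<lambda>t. (e' t - \<phi>' t - b t * d t) * exp (- P t)"])
    fix x assume x: "t0 \<le> x" "x \<le> t"
    then have x0: "x \<ge> 0" "x \<ge> T" using t0 T by auto
    show "((\<lambda>t. d t * exp (- P t)) has_hderiv (e' x - \<phi>' x - b x * d x) * exp (- P x)) x"
      unfolding d_def
      by (auto intro!: derivative_eq_intros e(1)[OF x0(2)] phi[OF x0(1)] P[OF x0(1)] simp: algebra_simps)
    show "(e' x - \<phi>' x - b x * d x) * exp (- P x) \<ge> 0" using d_ge[OF x0(2)] by simp
  qed (use t t0 T in auto)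
  \<comment> \<open>The distance \<open>d\<close> grows at least by the factor exp (P(t) - P(t0)),
    yet it never exceeds 1; so \<open>P\<close> would stay bounded.\<close>
  have "P t - P t0 \<le> ln (1 / d t0)" if t: "t \<ge> t0" for t
  proof -
    have "d t \<le> 1" using e(2)[of t] phi0[of t] t t0 T by (simp add: d_def)
    then have "d t * exp (- P t) \<le> exp (- P t)" by simp
    with grow[OF t] have "d t0 * exp (- P t0) \<le> exp (- P t)" by linarith
    then have "d t0 * exp (- P t0) * exp (P t) \<le> 1" by (simp add: exp_minus divide_simps)
    then have "exp (P t - P t0) \<le> 1 / d t0" using \<delta> by (simp add: d_def exp_diff exp_minus field_simps)
    then show ?thesis using \<delta> by (simp add: d_def ln_ge_iff)
  qed
  \<comment> \<open>Conversely b (1 + t) \<ge> 1 makes \<open>P\<close> grow at least like the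
    logarithm, which is the contradiction.\<close>
  moreover have "ln (1 + t) - ln (1 + t0) \<le> P t - P t0" if t: "t \<ge> t0" for t
  proof -
    have "P t0 - ln (1 + t0) \<le> P t - ln (1 + t)"
    proof (rule hderiv_nonneg_imp_le[where f = "\<lambda>t. P t - ln (1 + t)" and f' = "\<lambda>t. b t - 1 / (1 + t)"])
      fix x assume x: "t0 \<le> x" "x \<le> t"
      then have x0: "x \<ge> 0" "x \<ge> T" using t0 T by auto
      show "((\<lambda>t. P t - ln (1 + t)) has_hderiv b x - 1 / (1 + x)) x"
        using x0 by (auto intro!: derivative_eq_intros P[OF x0(1)])
      show "b x - 1 / (1 + x) \<ge> 0" using T(3)[OF x0(2)] x0 by (simp add: field_simps)
    qed (use t t0 T in auto)
    then show ?thesis by simp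
  qed
  ultimately have bd: "ln (1 + t) \<le> ln (1 / d t0) + ln (1 + t0)" if "t \<ge> t0" for t
    using that by (smt (verit))
  define t where "t = max t0 (exp (ln (1 / d t0) + ln (1 + t0)))"
  have "ln (exp (ln (1 / d t0) + ln (1 + t0))) < ln (1 + t)"
    unfolding t_def using t0 T by (intro ln_less_cancel_iff[THEN iffD2]) (auto simp: add_pos_nonneg)
  then show False using bd[of t] by (simp add: t_def)
qed

text \<open>The hypotheses are symmetric under a change of sign of \<open>e\<close>, so the upper
  barrier applies to \<open>e\<close> and to its negative.\<close>

lemma unstable_bounded_solution:
  fixes b e :: "real \<Rightarrow> real"
  assumes b: "\<And>t. t \<ge> 0 \<Longrightarrow> (b has_hderiv b' t) t" "\<And>t. t \<ge> 0 \<Longrightarrow> b t > 0"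
    and b': "\<And>t. t \<ge> 0 \<Longrightarrow> \<bar>b' t\<bar> \<le> C * b t / (1 + t)"
    and T: "T \<ge> 0" "\<And>t. t \<ge> T \<Longrightarrow> 2 * (C + 1) \<le> b t * (1 + t)" "\<And>t. t \<ge> T \<Longrightarrow> b t * (1 + t) \<ge> 1"
    and H: "H \<ge> 0"
    and e: "\<And>t. t \<ge> T \<Longrightarrow> (e has_hderiv e' t) t" "\<And>t. t \<ge> T \<Longrightarrow> \<bar>e t\<bar> \<le> 1"
      "\<And>t. t \<ge> T \<Longrightarrow> \<bar>e' t - b t * e t\<bar> \<le> H / (1 + t)"
    and t: "t \<ge> T"
  shows "\<bar>e t\<bar> \<le> 2 * H / (b t * (1 + t))"
proof -
  have "e t \<le> 2 * H / (b t * (1 + t))"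
  proof (rule unstable_upper_barrier[OF b b' T H e(1) _ _ t])
    fix s assume s: "s \<ge> T"
    show "e s \<le> 1" "e' s \<ge> b s * e s - H / (1 + s)" using e(2,3)[OF s] by linarith+
  qed
  moreover have "- e t \<le> 2 * H / (b t * (1 + t))"
  proof (rule unstable_upper_barrier[OF b b' T H _ _ _ t, where e = "\<lambda>s. - e s" and e' = "\<lambda>s. - e' s"])
    fix s assume s: "s \<ge> T"
    show "((\<lambda>s. - e s) has_hderiv - e' s) s" using e(1)[OF s] by (rule DERIV_minus)
    show "- e s \<le> 1" "- e' s \<ge> b s * - e s - H / (1 + s)" using e(2,3)[OF s] by auto
  qed
  ultimately show ?thesis by linarith
qed

section \<open>Damping and mass\<close>

text \<open>The first derivatives are parameters, so that differentiation rules apply directly, and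
  one constant \<open>C\<close> serves both derivative bounds.\<close>

locale damping_mass =
  fixes b b' m m' :: "real \<Rightarrow> real" and C :: real
  assumes b: "\<And>t. t \<ge> 0 \<Longrightarrow> (b has_hderiv b' t) t"
    and b'_cont: "continuous_on {0..} b'"
    and b_pos: "\<And>t. t \<ge> 0 \<Longrightarrow> b t > 0"
    and b'_le: "\<And>t. t \<ge> 0 \<Longrightarrow> \<bar>b' t\<bar> \<le> C * b t / (1 + t)"
    and b_lim: "filterlim (\<lambda>t. t * b t) at_top at_top"
    and b_int: "set_integrable lborel {0<..} (\<lambda>t. 1 / (b t * (1 + t)\<^sup>2))"
    and m: "\<And>t. t \<ge> 0 \<Longrightarrow> (m has_hderiv m' t) t"
    and m_pos: "\<And>t. t \<ge> 0 \<Longrightarrow> m t > 0"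
    and m'_le: "\<And>t. t \<ge> 0 \<Longrightarrow> \<bar>m' t\<bar> \<le> C * m t / (1 + t)"
    and C_pos: "C > 0"
begin

lemma b_cont: "continuous_on {0..} b" and m_cont: "continuous_on {0..} m"
  by (rule hderiv_continuous_on, erule b) (rule hderiv_continuous_on, erule m)

lemma b_nz: "t \<ge> 0 \<Longrightarrow> b t \<noteq> 0"
  using b_pos[of t] by simp

lemma B_int_has_hderiv: "t \<ge> 0 \<Longrightarrow> (B_int b has_hderiv 1 / b t) t"
  unfolding B_int_def [abs_def]
  by (intro integral_has_hderiv continuous_intros b_cont) (auto simp: b_nz)

lemma B_int_mono: "0 \<le> s \<Longrightarrow> s \<le> t \<Longrightarrow> B_int b s \<le> B_int b t"
  by (rule hderiv_nonneg_imp_le[OF _ _ B_int_has_hderiv]) (auto simp: less_imp_le[OF b_pos])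

lemma B_int_nonneg: "t \<ge> 0 \<Longrightarrow> B_int b t \<ge> 0"
  using B_int_mono[of 0 t] by (simp add: B_int_def)

lemma Q_int_has_hderiv: "t \<ge> 0 \<Longrightarrow> ((\<lambda>t. Q_int b m t 0) has_hderiv (m t)\<^sup>2 / b t) t"
  unfolding Q_int_def
  by (intro integral_has_hderiv continuous_intros b_cont m_cont) (auto simp: b_nz)

lemma Q_int_split: "0 \<le> r \<Longrightarrow> r \<le> t \<Longrightarrow> Q_int b m t r = Q_int b m t 0 - Q_int b m r 0"
  unfolding Q_int_def
  by (intro integral_halfline_split continuous_intros b_cont m_cont) (auto simp: b_nz)

section \<open>Doubling windows and the pointwise mass bound\<close>

text \<open>Since t |b'| \<le> C b, the derivative of t / b is at most (1 + C) / b, and both sides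
  vanish at 0.\<close>

lemma quotient_le_B_int:
  assumes t: "t \<ge> 0"
  shows "t / b t \<le> (1 + C) * B_int b t"
proof -
  let ?f = "\<lambda>x. (1 + C) * B_int b x - x / b x"
  have "?f 0 \<le> ?f t"
  proof (rule hderiv_nonneg_imp_le[where f = ?f and f' = "\<lambda>x. (C * b x + x * b' x) / (b x)\<^sup>2"])
    fix x :: real assume x: "0 \<le> x" "x \<le> t"
    show "(?f has_hderiv (C * b x + x * b' x) / (b x)\<^sup>2) x"
      using b_nz[OF x(1)]
      by (auto intro!: derivative_eq_intros B_int_has_hderiv[OF x(1)] b[OF x(1)]
          simp: field_simps power2_eq_square)
    have "x * \<bar>b' x\<bar> \<le> (1 + x) * (C * b x / (1 + x))"
      using b'_le[OF x(1)] x by (intro mult_mono) auto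
    then have "C * b x + x * b' x \<ge> 0"
      using x abs_mult[of x "b' x"] by simp
    then show "(C * b x + x * b' x) / (b x)\<^sup>2 \<ge> 0" by simp
  qed (use t in auto)
  then show ?thesis by (simp add: B_int_def)
qed

text \<open>By the preceding bound the logarithmic derivative 1 / (b (1 + B)) of 1 + B is at most (1
  + C) / x; integrating this over the window gives the claim, uniformly in \<open>r\<close>.\<close>

lemma ln_X_ratio_doubling:
  assumes r: "r > 0"
  shows "ln (X_ratio b (2 * r) r) \<le> (1 + C) * ln 2"
proof -
  let ?f = "\<lambda>x. (1 + C) * ln x - ln (1 + B_int b x)"
  have "?f r \<le> ?f (2 * r)"
  proof (rule hderiv_nonneg_imp_le[where f = ?f and
        f' = "\<lambda>x. (1 + C) / x - 1 / b x / (1 + B_int b x)"])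
    fix x :: real assume x: "r \<le> x" "x \<le> 2 * r"
    then have x0: "x \<ge> 0" using r by simp
    have B: "1 + B_int b x > 0" using B_int_nonneg[OF x0] by simp
    show "(?f has_hderiv (1 + C) / x - 1 / b x / (1 + B_int b x)) x"
      using x r B by (auto intro!: derivative_eq_intros B_int_has_hderiv[OF x0] simp: field_simps)
    have "x / b x \<le> (1 + C) * (1 + B_int b x)"
      using quotient_le_B_int[OF x0] C_pos by (simp add: algebra_simps)
    then have "x / b x / (1 + B_int b x) \<le> 1 + C"
      using B by (simp only: pos_divide_le_eq)
    then show "(1 + C) / x - 1 / b x / (1 + B_int b x) \<ge> 0"
      using x r by (simp add: pos_le_divide_eq mult.commute)
  qed (use r in auto)
  moreover have "ln (X_ratio b (2 * r) r) = ln (1 + B_int b (2 * r)) - ln (1 + B_int b r)"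
    using B_int_nonneg[of r] B_int_nonneg[of "2 * r"] r unfolding X_ratio_def
    by (intro ln_divide_pos) auto
  ultimately show ?thesis using r by (simp add: ln_mult algebra_simps)
qed

text \<open>The logarithmic derivative of m^2 / b is at least - 3 C / (1 + t), with 2 C coming from
  m^2 and C from b. As 1 + x \<le> 2 (1 + r) on the window, the density drops at most by the factor
  2 to the power - 3 C.\<close>

lemma mass_density_doubling:
  assumes r: "r \<ge> 0" and x: "r \<le> x" "x \<le> 2 * r"
  shows "exp (- (3 * C * ln 2)) * ((m r)\<^sup>2 / b r) \<le> (m x)\<^sup>2 / b x"
proof -
  let ?f = "\<lambda>x. 2 * ln (m x) - ln (b x) + 3 * C * ln (1 + x)"
  have "?f r \<le> ?f x"
  proof (rule hderiv_nonneg_imp_le[where f = ?f and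
        f' = "\<lambda>x. 2 * (m' x / m x) - b' x / b x + 3 * C / (1 + x)"])
    fix y assume y: "r \<le> y" "y \<le> x"
    then have y0: "y \<ge> 0" using r by simp
    show "(?f has_hderiv 2 * (m' y / m y) - b' y / b y + 3 * C / (1 + y)) y"
      using b_pos[OF y0] m_pos[OF y0] y0
      by (auto intro!: derivative_eq_intros b[OF y0] m[OF y0])
    have "\<bar>m' y / m y\<bar> \<le> C / (1 + y)" "\<bar>b' y / b y\<bar> \<le> C / (1 + y)"
      using m'_le[OF y0] b'_le[OF y0] b_pos[OF y0] m_pos[OF y0] y0
      by (auto simp: abs_divide field_simps)
    moreover have "3 * C / (1 + y) = 3 * (C / (1 + y))" by simp
    ultimately show "2 * (m' y / m y) - b' y / b y + 3 * C / (1 + y) \<ge> 0" by linarith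
  qed (use r x in auto)
  moreover have "ln (1 + x) \<le> ln (2 * (1 + r))"
    using x r by (intro ln_mono) auto
  then have "ln (1 + x) \<le> ln 2 + ln (1 + r)"
    using r ln_mult_pos[of 2 "1 + r"] by linarith
  then have "3 * C * ln (1 + x) \<le> 3 * C * (ln 2 + ln (1 + r))"
    using C_pos by (intro mult_left_mono) auto
  ultimately have le: "2 * ln (m r) - ln (b r) - 3 * C * ln 2 \<le> 2 * ln (m x) - ln (b x)"
    by (simp add: algebra_simps)
  have eq: "exp (2 * ln (m y) - ln (b y)) = (m y)\<^sup>2 / b y" if "y \<ge> 0" for y
    using b_pos[OF that] m_pos[OF that] by (simp add: exp_diff exp_double)
  have "exp (- (3 * C * ln 2)) * exp (2 * ln (m r) - ln (b r)) \<le> exp (2 * ln (m x) - ln (b x))"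
    using le by (simp add: exp_add[symmetric])
  then show ?thesis using eq[of r] eq[of x] r x by simp
qed

text \<open>The supremum dominates a nonnegative real and is finite by hypothesis, so
  \<open>real_of_ereal\<close> returns its true value.\<close>

lemma mass_excess_upper:
  assumes fin: "mass_excess b m \<beta> T\<^sub>0 L < \<infinity>"
    and tr: "r \<le> t" "T\<^sub>0 \<le> r" "ln (X_ratio b t r) \<le> L"
  shows "max (Q_int b m t r - \<beta> * ln (X_ratio b t r)) 0 \<le> real_of_ereal (mass_excess b m \<beta> T\<^sub>0 L)"
proof -
  have le: "ereal (max (Q_int b m t r - \<beta> * ln (X_ratio b t r)) 0) \<le> mass_excess b m \<beta> T\<^sub>0 L"
    unfolding mass_excess_def using tr by (intro SUP_upper2[of "(t, r)"]) auto
  then have "mass_excess b m \<beta> T\<^sub>0 L \<noteq> - \<infinity>" by auto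
  with fin le show ?thesis by (cases "mass_excess b m \<beta> T\<^sub>0 L") auto
qed

text \<open>The balance condition on the windows \<open>[r, 2 r]\<close>, whose logarithmic length is bounded, controls
  the mass pointwise.\<close>

lemma mass_bound:
  assumes fin: "\<And>L. L \<ge> 0 \<Longrightarrow> mass_excess b m \<beta> T\<^sub>0 L < \<infinity>" and \<beta>: "\<beta> \<ge> 0"
  obtains K where "K > 0" "\<And>t. t \<ge> max T\<^sub>0 1 \<Longrightarrow> (m t)\<^sup>2 \<le> K * b t / (1 + t)"
proof -
  define L where "L = (1 + C) * ln 2"
  have L: "L \<ge> 0" using C_pos by (simp add: L_def)
  define \<Omega> where "\<Omega> = real_of_ereal (mass_excess b m \<beta> T\<^sub>0 L)"
  define \<kappa> where "\<kappa> = exp (- (3 * C * ln 2))"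
  have \<kappa>: "\<kappa> > 0" by (simp add: \<kappa>_def)
  \<comment> \<open>The factor 2 replaces \<open>r\<close> by \<open>1 + r\<close>, using r \<ge> 1;
    \<kappa> is the loss of density across the window; the summand 1 keeps \<open>K\<close>
    positive.\<close>
  define K where "K = 2 * (\<bar>\<Omega>\<bar> + \<beta> * L + 1) / \<kappa>"
  show ?thesis
  proof (rule that)
    show "K > 0" using \<beta> L \<kappa> by (simp add: K_def add_nonneg_pos)
    fix r assume r: "r \<ge> max T\<^sub>0 1"
    then have r0: "r > 0" "r \<ge> 0" "r \<ge> T\<^sub>0" "r \<ge> 1" by auto
    have X: "ln (X_ratio b (2 * r) r) \<le> L"
      using ln_X_ratio_doubling[OF r0(1)] by (simp add: L_def)
    have "Q_int b m (2 * r) r - \<beta> * ln (X_ratio b (2 * r) r) \<le> \<Omega>"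
      using mass_excess_upper[OF fin[OF L] _ r0(3) X] r0 by (simp add: \<Omega>_def)
    moreover have "\<beta> * ln (X_ratio b (2 * r) r) \<le> \<beta> * L"
      using X \<beta> by (intro mult_left_mono) auto
    ultimately have Q: "Q_int b m (2 * r) r \<le> \<Omega> + \<beta> * L" by simp
    \<comment> \<open>A lower bound for the density on the entire window, so \<open>?g\<close> times
      the window length \<open>r\<close> is at most \<open>Q\<close> over the window.\<close>
    let ?g = "\<kappa> * ((m r)\<^sup>2 / b r)"
    let ?f = "\<lambda>x. Q_int b m x 0 - ?g * x"
    have "?f r \<le> ?f (2 * r)"
    proof (rule hderiv_nonneg_imp_le[where f = ?f and f' = "\<lambda>x. (m x)\<^sup>2 / b x - ?g"])
      fix x assume x: "r \<le> x" "x \<le> 2 * r"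
      then have x0: "x \<ge> 0" using r0 by simp
      show "(?f has_hderiv (m x)\<^sup>2 / b x - ?g) x"
        using Q_int_has_hderiv[OF x0] by (rule DERIV_diff[OF _ DERIV_cmult_Id])
      show "(m x)\<^sup>2 / b x - ?g \<ge> 0"
        using mass_density_doubling[OF r0(2) x] by (simp add: \<kappa>_def)
    qed (use r0 in auto)
    then have "?g * r \<le> Q_int b m (2 * r) r"
      using Q_int_split[OF r0(2), of "2 * r"] r0 b_nz[OF r0(2)] by (simp add: algebra_simps)
    also have "\<dots> \<le> \<bar>\<Omega>\<bar> + \<beta> * L + 1" using Q by linarith
    finally have "\<kappa> * (m r)\<^sup>2 * r \<le> (\<bar>\<Omega>\<bar> + \<beta> * L + 1) * b r"
      using b_pos[OF r0(2)] by (simp add: field_simps)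
    moreover have "\<kappa> * (m r)\<^sup>2 * (1 + r) \<le> 2 * (\<kappa> * (m r)\<^sup>2 * r)"
      using mult_left_mono[of "1 + r" "2 * r" "\<kappa> * (m r)\<^sup>2"] r0 \<kappa> by (simp add: mult_ac)
    ultimately have "\<kappa> * (m r)\<^sup>2 * (1 + r) \<le> 2 * ((\<bar>\<Omega>\<bar> + \<beta> * L + 1) * b r)" by linarith
    then have "(m r)\<^sup>2 * (\<kappa> * (1 + r)) \<le> 2 * (\<bar>\<Omega>\<bar> + \<beta> * L + 1) * b r" by (simp only: mult_ac)
    then have "(m r)\<^sup>2 \<le> 2 * (\<bar>\<Omega>\<bar> + \<beta> * L + 1) * b r / (\<kappa> * (1 + r))"
      using \<kappa> r0 by (subst pos_le_divide_eq) auto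
    then show "(m r)\<^sup>2 \<le> K * b r / (1 + r)" by (simp add: K_def)
  qed
qed

section \<open>Consequences of integrability and of t b(t) \<rightarrow> \<infinity>\<close>

text \<open>The bound is the integral over the whole half-line: Lebesgue integrability on
  \<open>{0<..}\<close> passes to the gauge integral, and adding the null set \<open>{0}\<close>
  changes nothing.\<close>

lemma weight_integral_bounded:
  obtains D where "\<And>t. t \<ge> 0 \<Longrightarrow> integral {0..t} (\<lambda>s. 1 / (b s * (1 + s)\<^sup>2)) \<le> D"
proof
  fix t :: real assume t: "t \<ge> 0"
  let ?f = "\<lambda>s. 1 / (b s * (1 + s)\<^sup>2)"
  have "?f integrable_on {0..t}"
    by (intro integrable_continuous_real continuous_intros continuous_on_subset[OF b_cont])
      (auto simp: b_nz)
  moreover have "?f integrable_on {0<..}"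
    using set_borel_integral_eq_integral(1)[OF b_int] .
  then have "?f integrable_on {0..}"
    by (rule integrable_spike_set) (rule negligible_subset[of "{0}"]; force)+
  ultimately show "integral {0..t} ?f \<le> integral {0..} ?f"
    using b_pos by (intro integral_subset_le) (auto simp: less_imp_le)
qed

lemma eventually_b_large:
  obtains T where "T \<ge> T\<^sub>1" "\<And>t. t \<ge> T \<Longrightarrow> N \<le> b t * (1 + t)"
proof -
  from b_lim have "\<forall>\<^sub>F t in at_top. N \<le> t * b t" by (simp add: filterlim_at_top)
  then obtain T where T: "\<And>t. t \<ge> T \<Longrightarrow> N \<le> t * b t" by (auto simp: eventually_at_top_linorder)
  show ?thesis
  proof (rule that[of "max T (max 0 T\<^sub>1)"])
    fix t assume "t \<ge> max T (max 0 T\<^sub>1)"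
    then show "N \<le> b t * (1 + t)" using T[of t] b_pos[of t] by (simp add: algebra_simps)
  qed simp
qed

section \<open>The adjoint equation as a first-order system\<close>

text \<open>Differentiating \<rho>' = b \<rho> - w and inserting w' = m^2 \<rho> gives the adjoint
  equation. The resulting formula for \<rho>'' is continuous, which yields the regularity.\<close>

lemma adjoint_solutionI:
  assumes \<rho>: "\<And>t. t \<ge> 0 \<Longrightarrow> (\<rho> has_hderiv b t * \<rho> t - w t) t"
    and w: "\<And>t. t \<ge> 0 \<Longrightarrow> (w has_hderiv (m t)\<^sup>2 * \<rho> t) t"
  shows "adjoint_solution b m \<rho>"
proof -
  define D2 where "D2 t = b' t * \<rho> t + b t * (b t * \<rho> t - w t) - (m t)\<^sup>2 * \<rho> t" for t
  have h1: "hderiv \<rho> t = b t * \<rho> t - w t" if "t \<ge> 0" for t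
    using hderiv_eqI[OF \<rho>[OF that] that] .
  have d1: "((\<lambda>s. b s * \<rho> s - w s) has_hderiv D2 t) t" if "t \<ge> 0" for t
    unfolding D2_def
    by (auto intro!: derivative_eq_intros b[OF that] \<rho>[OF that] w[OF that])
  have d2: "(hderiv \<rho> has_hderiv D2 t) t" if "t \<ge> 0" for t
    by (rule has_hderiv_cong[OF d1[OF that] that]) (auto simp: h1)
  have h2: "hderiv (hderiv \<rho>) t = D2 t" if "t \<ge> 0" for t
    using hderiv_eqI[OF d2[OF that] that] .
  have h3: "hderiv (\<lambda>s. b s * \<rho> s) t = b' t * \<rho> t + b t * (b t * \<rho> t - w t)" if "t \<ge> 0" for t
    by (rule hderiv_eqI[OF _ that]) (auto intro!: derivative_eq_intros b[OF that] \<rho>[OF that])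
  have "continuous_on {0..} D2"
    unfolding D2_def
    by (intro continuous_intros b_cont b'_cont m_cont hderiv_continuous_on[OF \<rho>] hderiv_continuous_on[OF w])
  then have "continuous_on {0..} (hderiv (hderiv \<rho>))"
    by (rule continuous_on_eq) (auto simp: h2)
  moreover have "\<rho> differentiable_on {0..}" "hderiv \<rho> differentiable_on {0..}"
    using \<rho> d2 by (auto simp: differentiable_on_def real_differentiable_def)
  ultimately show ?thesis
    unfolding adjoint_solution_def C2_halfline_def by (simp add: h2 h3 D2_def)
qed

text \<open>With E = exp (\<integral> b / 2), the pair is \<rho> = E z and w = E (b z / 2 - z') for
  the decaying solution \<open>z\<close>. Then z' \<le> 0 says exactly that w \<ge> b \<rho> / 2,
  which also makes \<open>w\<close> positive.\<close>

lemma positive_adjoint_pair: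
  assumes q_nonneg: "\<And>t. t \<ge> 0 \<Longrightarrow> (m t)\<^sup>2 \<le> (b t)\<^sup>2 / 4 + b' t / 2"
    and T: "T \<ge> 0" "\<And>t. t \<ge> T \<Longrightarrow> (m t)\<^sup>2 < (b t)\<^sup>2 / 4 + b' t / 2"
  obtains \<rho> w where "\<And>t. t \<ge> 0 \<Longrightarrow> (\<rho> has_hderiv b t * \<rho> t - w t) t"
    "\<And>t. t \<ge> 0 \<Longrightarrow> (w has_hderiv (m t)\<^sup>2 * \<rho> t) t"
    "\<And>t. t \<ge> 0 \<Longrightarrow> \<rho> t > 0" "\<And>t. t \<ge> 0 \<Longrightarrow> w t > 0"
    "\<And>t. t \<ge> 0 \<Longrightarrow> b t * \<rho> t \<le> 2 * w t"
proof -
  define q where "q t = (b t)\<^sup>2 / 4 + b' t / 2 - (m t)\<^sup>2" for t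
  have q_cont: "continuous_on {0..} q"
    unfolding q_def by (intro continuous_intros b_cont b'_cont m_cont) auto
  have q_ge: "q t \<ge> 0" if "t \<ge> 0" for t using q_nonneg[OF that] by (simp add: q_def)
  have q_gt: "q t > 0" if "t \<ge> T" for t using T(2)[OF that] by (simp add: q_def)
  obtain z z' where z: "\<And>t. t \<ge> 0 \<Longrightarrow> (z has_hderiv z' t) t"
    "\<And>t. t \<ge> 0 \<Longrightarrow> (z' has_hderiv q t * z t) t"
    "\<And>t. t \<ge> 0 \<Longrightarrow> z t > 0" "\<And>t. t \<ge> 0 \<Longrightarrow> z' t \<le> 0"
    using principal_solution[OF q_cont q_ge T(1) q_gt] by blast
  define E where "E t = exp (integral {0..t} b / 2)" for t
  have E: "(E has_hderiv b t / 2 * E t) t" if "t \<ge> 0" for t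
    unfolding E_def [abs_def]
    by (auto intro!: derivative_eq_intros integral_has_hderiv[OF b_cont that])
  have E_pos: "E t > 0" for t by (simp add: E_def)
  show ?thesis
  proof (rule that)
    fix t :: real assume t: "t \<ge> 0"
    have bz: "b t * z t > 0" using b_pos[OF t] z(3)[OF t] by simp
    show "((\<lambda>t. E t * z t) has_hderiv b t * (E t * z t) - E t * (b t * z t / 2 - z' t)) t"
      by (rule DERIV_cong[OF DERIV_mult[OF E[OF t] z(1)[OF t]]]) (simp add: algebra_simps)
    \<comment> \<open>The terms with \<open>z'\<close> cancel, and b^2 / 4 + b' / 2 - q is m^2 by
      the definition of \<open>q\<close>.\<close>
    show "((\<lambda>t. E t * (b t * z t / 2 - z' t)) has_hderiv (m t)\<^sup>2 * (E t * z t)) t"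
      by (rule DERIV_cong[OF DERIV_mult[OF E[OF t] DERIV_diff[OF DERIV_cdivide[OF
          DERIV_mult[OF b[OF t] z(1)[OF t]]] z(2)[OF t]]]])
        (simp add: q_def algebra_simps power2_eq_square)
    show "E t * z t > 0" using E_pos z(3)[OF t] by simp
    show "E t * (b t * z t / 2 - z' t) > 0" using E_pos z(4)[OF t] bz by (intro mult_pos_pos) auto
    have "E t * (b t * z t) \<le> E t * (b t * z t - 2 * z' t)"
      using E_pos[of t] z(4)[OF t] by (intro mult_left_mono) auto
    then show "b t * (E t * z t) \<le> 2 * (E t * (b t * z t / 2 - z' t))"
      by (simp add: algebra_simps)
  qed
qed

section \<open>Asymptotics of the adjoint pair\<close>

lemma adjoint_pair_asymptotics:
  assumes K: "K > 0" "T\<^sub>1 \<ge> 0" "\<And>t. t \<ge> T\<^sub>1 \<Longrightarrow> (m t)\<^sup>2 \<le> K * b t / (1 + t)"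
    and \<rho>: "\<And>t. t \<ge> 0 \<Longrightarrow> (\<rho> has_hderiv b t * \<rho> t - w t) t"
    and w: "\<And>t. t \<ge> 0 \<Longrightarrow> (w has_hderiv (m t)\<^sup>2 * \<rho> t) t"
    and pos: "\<And>t. t \<ge> 0 \<Longrightarrow> \<rho> t > 0" "\<And>t. t \<ge> 0 \<Longrightarrow> w t > 0"
    and le: "\<And>t. t \<ge> 0 \<Longrightarrow> b t * \<rho> t \<le> 2 * w t"
  obtains T D where "T \<ge> T\<^sub>1"
    "\<And>t. t \<ge> T \<Longrightarrow> \<bar>b t * \<rho> t / w t - 1\<bar> \<le> 1 / 5"
    "\<And>t. t \<ge> T \<Longrightarrow> \<bar>ln (w t) - ln (w T) - Q_int b m t T\<bar> \<le> D"
proof -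
  \<comment> \<open>In the Riccati equation for \<sigma>, the bound \<sigma> \<le> 2 gives 2 C / (1
    + t) for the term with b' / b and 4 K / (1 + t) for the term with \<sigma>^2.\<close>
  define H where "H = 2 * C + 4 * K"
  have H: "H > 0" using K C_pos by (simp add: H_def)
  \<comment> \<open>The part 10 H makes 2 H / (b (1 + t)) at most 1 / 5; the part 2 (C + 1) is the
    threshold required by the barrier argument.\<close>
  obtain T where T: "T \<ge> T\<^sub>1" "\<And>t. t \<ge> T \<Longrightarrow> 10 * H + 2 * (C + 1) \<le> b t * (1 + t)"
    using eventually_b_large[of T\<^sub>1 "10 * H + 2 * (C + 1)"] by blast
  have T0: "T \<ge> 0" using T K by simp
  define \<sigma> where "\<sigma> t = b t * \<rho> t / w t" for t
  define \<sigma>' where "\<sigma>' t = b t * (\<sigma> t - 1) + b' t / b t * \<sigma> t - (m t)\<^sup>2 / b t * (\<sigma> t)\<^sup>2" for t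
  have \<sigma>: "(\<sigma> has_hderiv \<sigma>' t) t" if t: "t \<ge> 0" for t
  proof -
    have nz: "w t \<noteq> 0" "b t \<noteq> 0" using pos[OF t] b_nz[OF t] by auto
    have "(\<sigma> has_hderiv ((b' t * \<rho> t + (b t * \<rho> t - w t) * b t) * w t
        - b t * \<rho> t * ((m t)\<^sup>2 * \<rho> t)) / (w t * w t)) t"
      unfolding \<sigma>_def [abs_def]
      by (rule DERIV_divide[OF DERIV_mult[OF b[OF t] \<rho>[OF t]] w[OF t] nz(1)])
    also have "((b' t * \<rho> t + (b t * \<rho> t - w t) * b t) * w t
        - b t * \<rho> t * ((m t)\<^sup>2 * \<rho> t)) / (w t * w t) = \<sigma>' t"
      using nz by (simp add: \<sigma>'_def \<sigma>_def divide_simps) algebra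
    finally show ?thesis .
  qed
  have \<sigma>_range: "0 < \<sigma> t" "\<sigma> t \<le> 2" if "t \<ge> 0" for t
    using le[OF that] pos[OF that] b_pos[OF that] by (auto simp: \<sigma>_def field_simps)
  have dens: "(m t)\<^sup>2 / b t \<le> K / (1 + t)" if "t \<ge> T" for t
    using K(3)[of t] that T T0 b_pos[of t] by (simp add: field_simps)
  have e: "\<bar>\<sigma> t - 1\<bar> \<le> 2 * H / (b t * (1 + t))" if t: "t \<ge> T" for t
  proof (rule unstable_bounded_solution[OF b b_pos b'_le T0 _ _ less_imp_le[OF H] _ _ _ t,
        where e' = \<sigma>'])
    fix s assume s: "s \<ge> T"
    then have s0: "s \<ge> 0" using T0 by simp
    show "2 * (C + 1) \<le> b s * (1 + s)" "b s * (1 + s) \<ge> 1"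
      using T(2)[OF s] H C_pos by auto
    show "((\<lambda>s. \<sigma> s - 1) has_hderiv \<sigma>' s) s"
      using \<sigma>[OF s0] by (auto intro!: derivative_eq_intros)
    show "\<bar>\<sigma> s - 1\<bar> \<le> 1" using \<sigma>_range[OF s0] by auto
    have "\<bar>b' s / b s\<bar> \<le> C / (1 + s)"
      using b'_le[OF s0] b_pos[OF s0] s0 by (simp add: abs_divide field_simps)
    then have "\<bar>b' s / b s * \<sigma> s\<bar> \<le> C / (1 + s) * 2"
      unfolding abs_mult using \<sigma>_range[OF s0] C_pos s0 by (intro mult_mono) auto
    moreover have "(\<sigma> s)\<^sup>2 \<le> 2\<^sup>2" using \<sigma>_range[OF s0] by (intro power_mono) auto
    then have "\<bar>(m s)\<^sup>2 / b s * (\<sigma> s)\<^sup>2\<bar> \<le> K / (1 + s) * 2\<^sup>2"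
      unfolding abs_mult using dens[OF s] b_pos[OF s0] K s0 by (intro mult_mono) auto
    moreover have "H / (1 + s) = C / (1 + s) * 2 + K / (1 + s) * 2\<^sup>2"
      by (simp add: H_def add_divide_distrib mult.commute)
    ultimately show "\<bar>\<sigma>' s - b s * (\<sigma> s - 1)\<bar> \<le> H / (1 + s)" unfolding \<sigma>'_def by linarith
  qed
  obtain J where J: "\<And>t. t \<ge> 0 \<Longrightarrow> integral {0..t} (\<lambda>s. 1 / (b s * (1 + s)\<^sup>2)) \<le> J"
    using weight_integral_bounded by blast
  define I where "I t = integral {0..t} (\<lambda>s. 1 / (b s * (1 + s)\<^sup>2))" for t
  have I: "(I has_hderiv 1 / (b t * (1 + t)\<^sup>2)) t" if "t \<ge> 0" for t
    unfolding I_def [abs_def] using that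
    by (intro integral_has_hderiv continuous_intros b_cont) (auto simp: b_nz)
  have I0: "I t \<ge> 0" if "t \<ge> 0" for t
    using hderiv_nonneg_imp_le[OF order_refl that I] b_pos
    by (auto simp: I_def less_imp_le)
  define k where "k = 2 * K * H"
  have k: "k > 0" using K H by (simp add: k_def)
  define F where "F t = ln (w t) - Q_int b m t 0" for t
  define F' where "F' t = (m t)\<^sup>2 / b t * (\<sigma> t - 1)" for t
  have F: "(F has_hderiv F' t) t" if t: "t \<ge> 0" for t
  proof -
    have "(F has_hderiv (m t)\<^sup>2 * \<rho> t / w t - (m t)\<^sup>2 / b t) t"
      unfolding F_def [abs_def] using pos[OF t]
      by (auto intro!: derivative_eq_intros w[OF t] Q_int_has_hderiv[OF t])
    also have "(m t)\<^sup>2 * \<rho> t / w t - (m t)\<^sup>2 / b t = F' t"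
      using pos[OF t] b_nz[OF t] by (simp add: F'_def \<sigma>_def field_simps)
    finally show ?thesis .
  qed
  have F'_le: "\<bar>F' t\<bar> \<le> k * (1 / (b t * (1 + t)\<^sup>2))" if t: "t \<ge> T" for t
  proof -
    have "\<bar>F' t\<bar> \<le> K / (1 + t) * (2 * H / (b t * (1 + t)))"
      unfolding F'_def abs_mult using dens[OF t] e[OF t] t T0 b_pos[of t] K
      by (intro mult_mono) auto
    also have "\<dots> = k * (1 / (b t * (1 + t)\<^sup>2))" by (simp add: k_def power2_eq_square mult_ac)
    finally show ?thesis .
  qed
  show ?thesis
  proof (rule that[of T "k * J"])
    show "T \<ge> T\<^sub>1" by fact
    fix t assume t: "t \<ge> T"
    have t0: "t \<ge> 0" using t T0 by simp
    have "2 * H / (b t * (1 + t)) \<le> 1 / 5"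
      using T(2)[OF t] H C_pos b_pos[OF t0] t0 by (simp add: divide_simps)
    then show "\<bar>b t * \<rho> t / w t - 1\<bar> \<le> 1 / 5"
      using e[OF t] by (simp add: \<sigma>_def)
    \<comment> \<open>The derivative of k I dominates |F'|, so both k I + F and k I - F are
      nondecreasing; since k I lies between 0 and k J, the total change of \<open>F\<close> is at
      most k J.\<close>
    have "(k * I T + F T \<le> k * I t + F t) \<and> (k * I T - F T \<le> k * I t - F t)"
    proof
      show "k * I T + F T \<le> k * I t + F t"
      proof (rule hderiv_nonneg_imp_le[where f = "\<lambda>t. k * I t + F t"
            and f' = "\<lambda>t. k * (1 / (b t * (1 + t)\<^sup>2)) + F' t"])
        fix s assume s: "T \<le> s" "s \<le> t"
        then have s0: "s \<ge> 0" using T0 by simp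
        show "((\<lambda>t. k * I t + F t) has_hderiv k * (1 / (b s * (1 + s)\<^sup>2)) + F' s) s"
          by (intro DERIV_add DERIV_cmult I F s0)
        show "k * (1 / (b s * (1 + s)\<^sup>2)) + F' s \<ge> 0" using F'_le[OF s(1)] by linarith
      qed (use t T0 in auto)
      show "k * I T - F T \<le> k * I t - F t"
      proof (rule hderiv_nonneg_imp_le[where f = "\<lambda>t. k * I t - F t"
            and f' = "\<lambda>t. k * (1 / (b t * (1 + t)\<^sup>2)) - F' t"])
        fix s assume s: "T \<le> s" "s \<le> t"
        then have s0: "s \<ge> 0" using T0 by simp
        show "((\<lambda>t. k * I t - F t) has_hderiv k * (1 / (b s * (1 + s)\<^sup>2)) - F' s) s"
          by (intro DERIV_diff DERIV_cmult I F s0)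
        show "k * (1 / (b s * (1 + s)\<^sup>2)) - F' s \<ge> 0" using F'_le[OF s(1)] by linarith
      qed (use t T0 in auto)
    qed
    moreover have "k * I t \<le> k * J" using J[OF t0] k by (simp add: I_def)
    moreover have "k * I T \<ge> 0" using I0[OF T0] k by simp
    ultimately have "\<bar>F t - F T\<bar> \<le> k * J" by linarith
    then show "\<bar>ln (w t) - ln (w T) - Q_int b m t T\<bar> \<le> k * J"
      using Q_int_split[OF T0 t] by (simp add: F_def algebra_simps)
  qed
qed

text \<open>Both m^2 and b' are O(b / (1 + t)), which is small against b^2 because t b(t)
  \<rightarrow> \<infinity>. This supplies the eventual strict positivity of the potential from
  which the decaying solution is built.\<close>

lemma mass_eventually_subcritical:
  assumes K: "K > 0" "T\<^sub>1 \<ge> 0" "\<And>t. t \<ge> T\<^sub>1 \<Longrightarrow> (m t)\<^sup>2 \<le> K * b t / (1 + t)"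
  obtains T where "T \<ge> 0" "\<And>t. t \<ge> T \<Longrightarrow> (m t)\<^sup>2 < (b t)\<^sup>2 / 4 + b' t / 2"
proof -
  obtain T where T: "T \<ge> T\<^sub>1" "\<And>t. t \<ge> T \<Longrightarrow> 8 * (C + K) \<le> b t * (1 + t)"
    using eventually_b_large[of T\<^sub>1 "8 * (C + K)"] by blast
  show ?thesis
  proof (rule that)
    show "T \<ge> 0" using T K by simp
    fix t assume t: "t \<ge> T"
    then have t0: "t \<ge> 0" using T K by simp
    have "8 * (C + K) * (b t / (1 + t)) \<le> b t * (1 + t) * (b t / (1 + t))"
      using T(2)[OF t] b_pos[OF t0] t0 by (intro mult_right_mono) auto
    also have "\<dots> = (b t)\<^sup>2" using t0 by (simp add: power2_eq_square)
    finally have "8 * (C * b t / (1 + t)) + 8 * (K * b t / (1 + t)) \<le> (b t)\<^sup>2"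
      by (simp add: algebra_simps add_divide_distrib)
    moreover have "C * b t / (1 + t) > 0" using C_pos b_pos[OF t0] t0 by simp
    moreover have "K * b t / (1 + t) > 0" using K b_pos[OF t0] t0 by simp
    moreover have "(b t)\<^sup>2 > 0" using b_pos[OF t0] by simp
    ultimately show "(m t)\<^sup>2 < (b t)\<^sup>2 / 4 + b' t / 2"
      using b'_le[OF t0] K(3)[of t] t T(1) by linarith
  qed
qed

text \<open>Here b \<rho> is \<open>w\<close> up to factors 4 / 5 and 6 / 5, and \<open>w\<close> is
  w(T) exp Q up to factors exp (- D) and exp D; the products of these factors are the
  constants.\<close>

lemma adjoint_pair_comparable:
  assumes T: "T \<ge> 0"
    and pos: "\<And>t. t \<ge> 0 \<Longrightarrow> \<rho> t > 0" "\<And>t. t \<ge> 0 \<Longrightarrow> w t > 0"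
    and near: "\<And>t. t \<ge> T \<Longrightarrow> \<bar>b t * \<rho> t / w t - 1\<bar> \<le> 1 / 5"
    and ln_w: "\<And>t. t \<ge> T \<Longrightarrow> \<bar>ln (w t) - ln (w T) - Q_int b m t T\<bar> \<le> D"
  shows "comparable_on {T..} \<rho> (\<lambda>t. 1 / b t * exp (Q_int b m t T))"
proof -
  define c\<^sub>1 c\<^sub>2 where "c\<^sub>1 = 4 / 5 * (w T * exp (- D))" and "c\<^sub>2 = 6 / 5 * (w T * exp D)"
  have c: "c\<^sub>1 > 0" "c\<^sub>2 > 0" using pos(2)[OF T] by (simp_all add: c\<^sub>1_def c\<^sub>2_def)
  define c where "c = max 1 (max (inverse c\<^sub>1) c\<^sub>2)"
  have c_inv: "inverse c \<le> c\<^sub>1"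
    using c le_imp_inverse_le[of "inverse c\<^sub>1" c] by (simp add: c_def)
  have bounds: "c\<^sub>1 * exp (Q_int b m t T) \<le> b t * \<rho> t \<and> b t * \<rho> t \<le> c\<^sub>2 * exp (Q_int b m t T)"
    if t: "t \<ge> T" for t
  proof -
    have t0: "t \<ge> 0" using t T by simp
    have w: "w t = exp (ln (w t))" "w T = exp (ln (w T))" using pos(2)[OF t0] pos(2)[OF T] by auto
    have "exp (ln (w T) - D + Q_int b m t T) \<le> exp (ln (w t))"
      "exp (ln (w t)) \<le> exp (ln (w T) + D + Q_int b m t T)"
      using ln_w[OF t] by (simp_all only: exp_le_cancel_iff)
    then have "w T * exp (- D) * exp (Q_int b m t T) \<le> w t" "w t \<le> w T * exp D * exp (Q_int b m t T)"
      using pos(2)[OF t0] pos(2)[OF T] by (simp_all add: exp_add exp_diff exp_minus field_simps)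
    moreover have "4 / 5 \<le> b t * \<rho> t / w t" "b t * \<rho> t / w t \<le> 6 / 5"
      using near[OF t] by linarith+
    then have "4 / 5 * w t \<le> b t * \<rho> t" "b t * \<rho> t \<le> 6 / 5 * w t"
      using pos(2)[OF t0]
      by (simp_all only: pos_le_divide_eq[of "w t"] pos_divide_le_eq[of "w t"])
    ultimately show ?thesis by (auto simp: c\<^sub>1_def c\<^sub>2_def)
  qed
  show ?thesis
    unfolding comparable_on_def
  proof (intro exI conjI ballI)
    show "c \<ge> 1" by (simp add: c_def)
    fix t assume "t \<in> {T..}"
    then have t: "t \<ge> T" and t0: "t \<ge> 0" using T by auto
    let ?e = "exp (Q_int b m t T)"
    have "inverse c * ?e \<le> c\<^sub>1 * ?e" "c\<^sub>2 * ?e \<le> c * ?e"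
      using c_inv by (auto simp: c_def)
    with bounds[OF t] have "inverse c * ?e \<le> \<rho> t * b t" "\<rho> t * b t \<le> c * ?e"
      by (simp_all only: mult.commute[of "\<rho> t"]) linarith+
    then have "inverse c * ?e / b t \<le> \<rho> t" "\<rho> t \<le> c * ?e / b t"
      using b_pos[OF t0] by (simp_all only: pos_divide_le_eq pos_le_divide_eq)
    then show "inverse c * (1 / b t * ?e) \<le> \<rho> t" "\<rho> t \<le> c * (1 / b t * ?e)" by simp_all
  qed
qed

section \<open>Growth bound and assembly\<close>

lemma mass_excess_nonneg:
  assumes fin: "mass_excess b m \<beta> T\<^sub>0 L < \<infinity>" and L: "L \<ge> 0" and T\<^sub>0: "T\<^sub>0 \<ge> 0"
  shows "real_of_ereal (mass_excess b m \<beta> T\<^sub>0 L) \<ge> 0"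
proof -
  have "ln (X_ratio b T\<^sub>0 T\<^sub>0) \<le> L"
    using L B_int_nonneg[OF T\<^sub>0] by (simp add: X_ratio_def)
  from mass_excess_upper[OF fin order_refl order_refl this] show ?thesis by linarith
qed

text \<open>As B(T) \<ge> 0, X(t, T) \<le> 1 + B(t), so the pair (t, T) is admissible at level L =
  ln (1 + B(t)); since \<beta> \<ge> 0, the subtracted \<beta> ln X is at most \<beta> L.\<close>

lemma exp_Q_int_le:
  assumes fin: "\<And>L. L \<ge> 0 \<Longrightarrow> mass_excess b m \<beta> T\<^sub>0 L < \<infinity>" and \<beta>: "\<beta> \<ge> 0"
    and T: "T \<ge> T\<^sub>0" "T \<ge> 0" "t \<ge> T"
  shows "exp (Q_int b m t T) \<le> (1 + B_int b t) powr \<beta> *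
    exp (real_of_ereal (mass_excess b m \<beta> T\<^sub>0 (ln (1 + B_int b t))))"
proof -
  have B: "B_int b T \<ge> 0" "B_int b t \<ge> 0" using B_int_nonneg T by auto
  have X: "X_ratio b t T > 0" "X_ratio b t T \<le> 1 + B_int b t"
    using B by (auto simp: X_ratio_def add_pos_nonneg divide_le_eq algebra_simps)
  then have ln_X: "ln (X_ratio b t T) \<le> ln (1 + B_int b t)" by (intro ln_mono) auto
  have L: "ln (1 + B_int b t) \<ge> 0" using B by simp
  have "Q_int b m t T - \<beta> * ln (X_ratio b t T)
      \<le> real_of_ereal (mass_excess b m \<beta> T\<^sub>0 (ln (1 + B_int b t)))"
    using mass_excess_upper[OF fin[OF L] T(3,1) ln_X] by linarith
  moreover have "\<beta> * ln (X_ratio b t T) \<le> \<beta> * ln (1 + B_int b t)"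
    using ln_X \<beta> by (intro mult_left_mono)
  ultimately have "exp (Q_int b m t T) \<le> exp (\<beta> * ln (1 + B_int b t) +
      real_of_ereal (mass_excess b m \<beta> T\<^sub>0 (ln (1 + B_int b t))))" by simp
  then show ?thesis using B by (simp add: exp_add powr_def)
qed

lemma adjoint_solution_exists:
  assumes fin: "\<And>L. L \<ge> 0 \<Longrightarrow> mass_excess b m \<beta> T\<^sub>0 L < \<infinity>" and \<beta>: "\<beta> \<ge> 0" and T\<^sub>0: "T\<^sub>0 \<ge> 0"
    and osc: "\<And>t. t \<ge> 0 \<Longrightarrow> (m t)\<^sup>2 \<le> (b t)\<^sup>2 / 4 + b' t / 2"
  shows "\<exists>\<rho>. adjoint_solution b m \<rho> \<and>
    (\<forall>t\<ge>0. \<rho> t > 0 \<and> b t * \<rho> t - hderiv \<rho> t > 0) \<and>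
    (\<exists>C>0. \<forall>t\<ge>0.
       \<bar>hderiv \<rho> t\<bar> \<le> C * b t * \<rho> t \<and>
       b t * \<rho> t \<le> C * (1 + B_int b t) powr \<beta> *
         exp (real_of_ereal (mass_excess b m \<beta> T\<^sub>0 (ln (1 + B_int b t))))) \<and>
    (\<exists>T\<ge>T\<^sub>0.
       comparable_on {T..} \<rho> (\<lambda>t. 1 / b t * exp (Q_int b m t T)) \<and>
       (\<forall>t\<ge>T. \<bar>hderiv \<rho> t / (b t * \<rho> t)\<bar> \<le> 1 / 4))"
proof -
  obtain K where K: "K > 0" "\<And>t. t \<ge> max T\<^sub>0 1 \<Longrightarrow> (m t)\<^sup>2 \<le> K * b t / (1 + t)"
    using mass_bound[OF fin \<beta>] by blast
  have T\<^sub>1: "max T\<^sub>0 1 \<ge> 0" by simp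
  obtain T' where T': "T' \<ge> 0" "\<And>t. t \<ge> T' \<Longrightarrow> (m t)\<^sup>2 < (b t)\<^sup>2 / 4 + b' t / 2"
    using mass_eventually_subcritical[OF K(1) T\<^sub>1 K(2)] by blast
  obtain \<rho> w where \<rho>: "\<And>t. t \<ge> 0 \<Longrightarrow> (\<rho> has_hderiv b t * \<rho> t - w t) t"
    and w: "\<And>t. t \<ge> 0 \<Longrightarrow> (w has_hderiv (m t)\<^sup>2 * \<rho> t) t"
    and pos: "\<And>t. t \<ge> 0 \<Longrightarrow> \<rho> t > 0" "\<And>t. t \<ge> 0 \<Longrightarrow> w t > 0"
    and le: "\<And>t. t \<ge> 0 \<Longrightarrow> b t * \<rho> t \<le> 2 * w t"
    using positive_adjoint_pair[OF osc T'] by blast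
  obtain T D where T: "T \<ge> max T\<^sub>0 1"
    and near: "\<And>t. t \<ge> T \<Longrightarrow> \<bar>b t * \<rho> t / w t - 1\<bar> \<le> 1 / 5"
    and ln_w: "\<And>t. t \<ge> T \<Longrightarrow> \<bar>ln (w t) - ln (w T) - Q_int b m t T\<bar> \<le> D"
    using adjoint_pair_asymptotics[OF K(1) T\<^sub>1 K(2) \<rho> w pos le] by blast
  have T0: "T \<ge> T\<^sub>0" "T \<ge> 0" using T by auto
  have comp: "comparable_on {T..} \<rho> (\<lambda>t. 1 / b t * exp (Q_int b m t T))"
    using adjoint_pair_comparable[OF T0(2) pos near ln_w] .
  then obtain c where c: "c \<ge> 1" "\<And>t. t \<ge> T \<Longrightarrow> \<rho> t \<le> c * (1 / b t * exp (Q_int b m t T))"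
    unfolding comparable_on_def by auto
  have d\<rho>: "hderiv \<rho> t = b t * \<rho> t - w t" if "t \<ge> 0" for t
    using hderiv_eqI[OF \<rho>[OF that] that] .
  have b\<rho>: "b t * \<rho> t > 0" if "t \<ge> 0" for t using b_pos[OF that] pos(1)[OF that] by simp
  \<comment> \<open>The tolerance 1 / 5 was chosen for this: |b \<rho> - w| \<le> w / 5 and b \<rho>
    \<ge> 4 w / 5 give the quotient 1 / 4.\<close>
  have quarter: "\<bar>hderiv \<rho> t / (b t * \<rho> t)\<bar> \<le> 1 / 4" if t: "t \<ge> T" for t
  proof -
    have t0: "t \<ge> 0" using t T0 by simp
    have "\<bar>b t * \<rho> t - w t\<bar> \<le> w t / 5"
      using near[OF t] pos(2)[OF t0] by (auto simp: abs_le_iff field_simps)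
    then have "\<bar>b t * \<rho> t - w t\<bar> \<le> b t * \<rho> t / 4" by linarith
    then show ?thesis using b\<rho>[OF t0] by (simp add: d\<rho>[OF t0] abs_divide pos_divide_le_eq)
  qed
  have cont: "continuous_on {0..} \<rho>" "continuous_on {0..} w"
    by (rule hderiv_continuous_on, erule \<rho>) (rule hderiv_continuous_on, erule w)
  have "continuous_on {0..} (\<lambda>t. (b t * \<rho> t - w t) / (b t * \<rho> t))"
    using b\<rho> by (intro continuous_intros cont b_cont) force
  then obtain M\<^sub>1 where M\<^sub>1: "M\<^sub>1 > 0"
    "\<And>t. 0 \<le> t \<Longrightarrow> t \<le> T \<Longrightarrow> \<bar>(b t * \<rho> t - w t) / (b t * \<rho> t)\<bar> \<le> M\<^sub>1"
    using continuous_bounded_initial by blast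
  have "continuous_on {0..} (\<lambda>t. b t * \<rho> t)" by (intro continuous_intros cont b_cont)
  then obtain M\<^sub>2 where M\<^sub>2: "M\<^sub>2 > 0" "\<And>t. 0 \<le> t \<Longrightarrow> t \<le> T \<Longrightarrow> \<bar>b t * \<rho> t\<bar> \<le> M\<^sub>2"
    using continuous_bounded_initial by blast
  \<comment> \<open>One constant for both estimates: \<open>M\<^sub>1\<close> and
    \<open>M\<^sub>2\<close> come from compactness of \<open>{0..T}\<close>, and c \<ge> 1 covers
    the tail, including the 1 / 4 there.\<close>
  define c' where "c' = M\<^sub>1 + M\<^sub>2 + c"
  define W where "W t = (1 + B_int b t) powr \<beta> *
    exp (real_of_ereal (mass_excess b m \<beta> T\<^sub>0 (ln (1 + B_int b t))))" for t
  have deriv_le: "\<bar>hderiv \<rho> t\<bar> \<le> c' * b t * \<rho> t" if t: "t \<ge> 0" for t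
  proof -
    have "\<bar>hderiv \<rho> t / (b t * \<rho> t)\<bar> \<le> c'"
    proof (cases "t \<ge> T")
      case True
      then show ?thesis using quarter[OF True] M\<^sub>1(1) M\<^sub>2(1) c(1) unfolding c'_def by linarith
    next
      case False
      then show ?thesis using M\<^sub>1(2)[OF t] M\<^sub>2(1) c(1) unfolding c'_def d\<rho>[OF t] by linarith
    qed
    then show ?thesis using b\<rho>[OF t] by (simp add: abs_divide pos_divide_le_eq mult.assoc)
  qed
  have growth: "b t * \<rho> t \<le> c' * W t" if t: "t \<ge> 0" for t
  proof (cases "t \<ge> T")
    case True
    have "b t * \<rho> t \<le> c * exp (Q_int b m t T)"
      using c(2)[OF True] b_pos[OF t] by (simp add: field_simps)
    also have "\<dots> \<le> c' * W t"
      unfolding W_def using exp_Q_int_le[OF fin \<beta> T0 True] c M\<^sub>1 M\<^sub>2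
      by (intro mult_mono) (auto simp: c'_def)
    finally show ?thesis .
  next
    case False
    have L: "ln (1 + B_int b t) \<ge> 0" using B_int_nonneg[OF t] by simp
    \<comment> \<open>On the initial segment the bound holds because the majorant is at least 1:
      both the power and the excess are nonnegative.\<close>
    have "W t \<ge> 1 * 1"
      unfolding W_def using B_int_nonneg[OF t] \<beta> mass_excess_nonneg[OF fin[OF L] L T\<^sub>0]
      by (intro mult_mono ge_one_powr_ge_zero) auto
    then have "c' * 1 \<le> c' * W t" using c M\<^sub>1 M\<^sub>2 by (intro mult_left_mono) (auto simp: c'_def)
    moreover have "b t * \<rho> t \<le> c'" using M\<^sub>2(2)[of t] M\<^sub>1(1) c(1) t False unfolding c'_def by linarith
    ultimately show ?thesis by linarith
  qed
  have "c' > 0" using M\<^sub>1 M\<^sub>2 c by (simp add: c'_def)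
  then show ?thesis
    using adjoint_solutionI[OF \<rho> w] pos d\<rho> deriv_le growth comp quarter T0(1)
    by (intro exI[of _ \<rho>] conjI exI[of _ c'] exI[of _ T]) (auto simp: W_def mult.assoc)
qed

end

theorem theorem12:
  fixes b m :: "real \<Rightarrow> real" and \<beta> T\<^sub>0 :: real
  assumes "effective_damping b"
    and "dominated_mass b m"
    and "accumulated_mass_balance b m \<beta> T\<^sub>0"
    and "liouville_nonoscillation b m"
  shows "\<exists>\<rho>. adjoint_solution b m \<rho> \<and>
    (\<forall>t\<ge>0. \<rho> t > 0 \<and> b t * \<rho> t - hderiv \<rho> t > 0) \<and>
    (\<exists>C>0. \<forall>t\<ge>0.
       \<bar>hderiv \<rho> t\<bar> \<le> C * b t * \<rho> t \<and>
       b t * \<rho> t \<le> C * (1 + B_int b t) powr \<beta> *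
         exp (real_of_ereal (mass_excess b m \<beta> T\<^sub>0 (ln (1 + B_int b t))))) \<and>
    (\<exists>T\<ge>T\<^sub>0.
       comparable_on {T..} \<rho> (\<lambda>t. 1 / b t * exp (Q_int b m t T)) \<and>
       (\<forall>t\<ge>T. \<bar>hderiv \<rho> t / (b t * \<rho> t)\<bar> \<le> 1 / 4))"
proof -
  note b = assms(1)[unfolded effective_damping_def C2_halfline_def]
  note m = assms(2)[unfolded dominated_mass_def C2_halfline_def]
  have b_pos: "\<And>t. t \<ge> 0 \<Longrightarrow> b t > 0" and m_pos: "\<And>t. t \<ge> 0 \<Longrightarrow> m t > 0" using b m by blast+
  obtain C\<^sub>b where C\<^sub>b: "C\<^sub>b > 0"
    "\<forall>k\<in>{1, 2}. \<forall>t\<ge>0. \<bar>(hderiv ^^ k) b t\<bar> \<le> C\<^sub>b * b t / (1 + t) ^ k" using b by blast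
  obtain C\<^sub>m where C\<^sub>m: "C\<^sub>m > 0"
    "\<forall>k\<in>{1, 2}. \<forall>t\<ge>0. \<bar>(hderiv ^^ k) m t\<bar> \<le> C\<^sub>m * m t / (1 + t) ^ k" using m by blast
  \<comment> \<open>The two derivative constants are added to give a common one; the case k = 1 of
    the derivative bounds is the one inserted.\<close>
  interpret damping_mass b "hderiv b" m "hderiv m" "C\<^sub>b + C\<^sub>m"
  proof
    fix t :: real assume t: "t \<ge> 0"
    show "(b has_hderiv hderiv b t) t" "(m has_hderiv hderiv m t) t"
      using b m t by (auto intro: has_hderiv_hderiv)
    show "b t > 0" "m t > 0" using b_pos m_pos t by auto
    have "\<bar>hderiv b t\<bar> \<le> C\<^sub>b * b t / (1 + t)" "\<bar>hderiv m t\<bar> \<le> C\<^sub>m * m t / (1 + t)"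
      using bspec[OF C\<^sub>b(2), of 1] bspec[OF C\<^sub>m(2), of 1] t by auto
    moreover have "C\<^sub>b * b t / (1 + t) \<le> (C\<^sub>b + C\<^sub>m) * b t / (1 + t)"
      "C\<^sub>m * m t / (1 + t) \<le> (C\<^sub>b + C\<^sub>m) * m t / (1 + t)"
      using C\<^sub>b(1) C\<^sub>m(1) b_pos[OF t] m_pos[OF t] t by (auto intro!: divide_right_mono)
    ultimately show "\<bar>hderiv b t\<bar> \<le> (C\<^sub>b + C\<^sub>m) * b t / (1 + t)"
      "\<bar>hderiv m t\<bar> \<le> (C\<^sub>b + C\<^sub>m) * m t / (1 + t)" by linarith+
  next
    show "continuous_on {0..} (hderiv b)" using b differentiable_imp_continuous_on by blast
    show "filterlim (\<lambda>t. t * b t) at_top at_top"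
      "set_integrable lborel {0<..} (\<lambda>t. 1 / (b t * (1 + t)\<^sup>2))" using b by blast+
    show "C\<^sub>b + C\<^sub>m > 0" using C\<^sub>b C\<^sub>m by simp
  qed
  show ?thesis
    using assms(3,4) unfolding accumulated_mass_balance_def liouville_nonoscillation_def
    by (intro adjoint_solution_exists) auto
qed

end
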